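(* Let $\nu>-1$. (a) The system $\{d_\nu\varphi_n^\nu : n\ge 2\}$ is complete in $L^2(d\eta_\nu)$. (b) The system $\{\delta_\nu\phi_n^\nu : n\ge 2\}$ is complete in $L^2(d\mu_\nu)$. (c) The system $\{\mathbb{D}_\nu\psi_n^\nu : n\ge 2\}$ is complete in $L^2(dx)$.
   Context: All $L^p$ spaces are over the interval $(0,1)$. For $\nu>-1$ let $J_\nu$ be the Bessel function of the first kind of order $\nu$ on $(0,\infty)$, and let $0<\lambda_{1,\nu}<\lambda_{2,\nu}<\dots$ be its successive positive zeros. For $n\ge1$ and $x\in(0,1)$ set $$\phi_n^\nu(x)=\frac{\sqrt2}{|J_{\nu+1}(\lambda_{n,\nu})|}x^{-\nu}J_\nu(\lambda_{n,\nu}x),\qquad \psi_n^\nu(x)=x^{\nu+1/2}\phi_n^\nu(x),\qquad \varphi_n^\nu(x)=\frac{\phi_n^\nu(x)}{\phi_1^\nu(x)}.$$ These are orthonormal bases of $L^2(d\mu_\nu)$, $L^2(dx)$ and $L^2(d\eta_\nu)$, respectively, where $d\mu_\nu(x)=x^{2\nu+1}dx$ and $d\eta_\nu(x)=x^{2\nu+1}[\phi_1^\nu(x)]^2dx$ on $(0,1)$. Let $$R^\nu(x)=\lambda_{1,\nu}\frac{J_{\nu+1}(\lambda_{1,\nu}x)}{J_\nu(\lambda_{1,\nu}x)},\qquad x\in(0,1),$$ and define the derivatives $$d_\nu=\frac{d}{dx},\qquad \delta_\nu=\frac{d}{dx}+R^\nu(x),\qquad \mathbb{D}_\nu=\frac{d}{dx}-\frac{\nu+1/2}{x}+R^\nu(x).$$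 A system is complete in a Hilbert space if its linear span is dense. *)

theory Defs
  imports "HOL-Analysis.Analysis"
begin

text \<open>The defining series of the Bessel function of the first kind, used for \<open>x > 0\<close>.\<close>

definition bessel_J :: "real \<Rightarrow> real \<Rightarrow> real" where
  "bessel_J \<nu> x =
    (\<Sum>k. (- 1) ^ k / (fact k * Gamma (real k + \<nu> + 1)) * (x / 2) powr (2 * real k + \<nu>))"

text \<open>For \<open>n \<ge> 1\<close>, the \<open>n\<close>-th positive zero is the positive zero that has exactly \<open>n\<close> zeros in
  \<open>{0<..x}\<close>.  (An infinite set has \<open>card\<close> equal to \<open>0\<close>, so for \<open>n \<ge> 1\<close> the set is finite.)\<close>

definition bessel_zero :: "real \<Rightarrow> nat \<Rightarrow> real" where
  "bessel_zero \<nu> n =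
    (THE x. 0 < x \<and> bessel_J \<nu> x = 0 \<and> card {y. 0 < y \<and> y \<le> x \<and> bessel_J \<nu> y = 0} = n)"

definition phi :: "real \<Rightarrow> nat \<Rightarrow> real \<Rightarrow> real" where
  "phi \<nu> n x = sqrt 2 / \<bar>bessel_J (\<nu> + 1) (bessel_zero \<nu> n)\<bar>
      * x powr (- \<nu>) * bessel_J \<nu> (bessel_zero \<nu> n * x)"

definition psi :: "real \<Rightarrow> nat \<Rightarrow> real \<Rightarrow> real" where
  "psi \<nu> n x = x powr (\<nu> + 1 / 2) * phi \<nu> n x"

definition varphi :: "real \<Rightarrow> nat \<Rightarrow> real \<Rightarrow> real" where
  "varphi \<nu> n x = phi \<nu> n x / phi \<nu> 1 x"

definition R_fun :: "real \<Rightarrow> real \<Rightarrow> real" where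
  "R_fun \<nu> x = bessel_zero \<nu> 1 * bessel_J (\<nu> + 1) (bessel_zero \<nu> 1 * x)
      / bessel_J \<nu> (bessel_zero \<nu> 1 * x)"

definition d_op :: "real \<Rightarrow> (real \<Rightarrow> real) \<Rightarrow> real \<Rightarrow> real" where
  "d_op \<nu> f x = deriv f x"

definition delta_op :: "real \<Rightarrow> (real \<Rightarrow> real) \<Rightarrow> real \<Rightarrow> real" where
  "delta_op \<nu> f x = deriv f x + R_fun \<nu> x * f x"

definition D_op :: "real \<Rightarrow> (real \<Rightarrow> real) \<Rightarrow> real \<Rightarrow> real" where
  "D_op \<nu> f x = deriv f x - (\<nu> + 1 / 2) / x * f x + R_fun \<nu> x * f x"

definition unit_measure :: "real measure" where
  "unit_measure = restrict_space lborel {0<..<1}"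

definition mu_measure :: "real \<Rightarrow> real measure" where
  "mu_measure \<nu> = density unit_measure (\<lambda>x. ennreal (x powr (2 * \<nu> + 1)))"

definition eta_measure :: "real \<Rightarrow> real measure" where
  "eta_measure \<nu> = density unit_measure (\<lambda>x. ennreal (x powr (2 * \<nu> + 1) * (phi \<nu> 1 x)\<^sup>2))"

text \<open>Real scalars.  Elements of \<open>L\<^sup>2\<close> are represented by functions; no quotient by almost everywhere equality
  is needed to express density.\<close>

definition L2_space :: "'a measure \<Rightarrow> ('a \<Rightarrow> real) set" where
  "L2_space M = {f \<in> borel_measurable M. integrable M (\<lambda>x. (f x)\<^sup>2)}"

definition L2_norm :: "'a measure \<Rightarrow> ('a \<Rightarrow> real) \<Rightarrow> real" where
  "L2_norm M f = sqrt (\<integral>x. (f x)\<^sup>2 \<partial>M)"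

definition family_span :: "('i \<Rightarrow> 'a \<Rightarrow> real) \<Rightarrow> 'i set \<Rightarrow> ('a \<Rightarrow> real) set" where
  "family_span f I = {(\<lambda>x. \<Sum>i\<in>A. c i * f i x) | A c. finite A \<and> A \<subseteq> I}"

text \<open>Membership of the system in the space is part of completeness.\<close>

definition complete_in_L2 :: "'a measure \<Rightarrow> ('i \<Rightarrow> 'a \<Rightarrow> real) \<Rightarrow> 'i set \<Rightarrow> bool" where
  "complete_in_L2 M f I \<longleftrightarrow>
    (\<forall>i\<in>I. f i \<in> L2_space M) \<and>
    (\<forall>g\<in>L2_space M. \<forall>\<epsilon>>0. \<exists>h\<in>family_span f I. L2_norm M (\<lambda>x. g x - h x) < \<epsilon>)"

end

theory Submission
  imports Defs "HOL-Complex_Analysis.Complex_Analysis"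
begin

text \<open>
  With \<open>\<phi> = \<phi>\<^sub>1\<close> and \<open>\<rho>(x) = x\<^bsup>\<nu>+1/2\<^esup>\<close> one has \<open>\<phi> d(\<phi>\<^sub>n / \<phi>) = \<delta> \<phi>\<^sub>n\<close> and \<open>D \<psi>\<^sub>n = \<rho> \<delta> \<phi>\<^sub>n\<close>, so the three
  claims are unitarily equivalent. The functions \<open>\<rho> \<delta> (\<phi> p(x\<^sup>2)) = 2 x \<rho> \<phi> p'(x\<^sup>2)\<close>, \<open>p\<close> a polynomial, are dense
  in \<open>L\<^sup>2(0,1)\<close> by Weierstrass' theorem. For \<open>f = \<phi> p(x\<^sup>2)\<close>, which vanishes at 1, let \<open>F\<close> be the remainder of the
  Fourier-Bessel expansion of \<open>f\<close> after all eigenvalues below \<open>R\<close>. Picone's identity bounds the norm of \<open>\<delta> F\<close> by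
  the energy \<open>\<langle>A F, F\<rangle>\<close> of the Bessel operator \<open>A\<close>, and it remains to show that the energy tends to 0 as \<open>R\<close> grows.

  Put \<open>h = A F\<close>. Since \<open>h\<close> is orthogonal to all eigenfunctions with eigenvalue below \<open>R\<close>, the resolvent
  \<open>(A - w)\<^sup>-\<^sup>1 h\<close>, a quotient of entire functions of \<open>w\<close> whose denominator is essentially the Bessel function,
  is holomorphic for \<open>|w| < R\<close>; hence its Taylor coefficients \<open>A\<^sup>-\<^sup>k h\<close> are \<open>O(r\<^sup>-\<^sup>k)\<close> for every \<open>r < R\<close>. By symmetry
  of \<open>A\<close> the norms of \<open>A\<^sup>-\<^sup>k h\<close> are log-convex in \<open>k\<close>, so already the first ratio is at most \<open>1/R\<close> and
  \<open>\<langle>A F, F\<rangle> = \<langle>h, A\<^sup>-\<^sup>1 h\<rangle> \<le> \<parallel>h\<parallel>\<^sup>2 / R \<le> \<parallel>A f\<parallel>\<^sup>2 / R\<close>.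
\<close>

section \<open>Everywhere convergent power series\<close>

text \<open>Formal series turn operator identities into comparisons of coefficients, and entire ones
  can be evaluated everywhere. The scalars stay generic because both real and complex series
  occur.\<close>

definition entire :: "'a :: {banach, real_normed_field} fps \<Rightarrow> bool" where
  "entire F \<longleftrightarrow> fps_conv_radius F = \<infinity>"

lemma entire_iff_summable: "entire F \<longleftrightarrow> (\<forall>r>0. summable (\<lambda>n. norm (fps_nth F n) * r ^ n))"
proof
  assume "entire F"
  then have "summable (\<lambda>n. norm (fps_nth F n * of_real r ^ n))" if "r > 0" for r :: real
    by (intro norm_summable_fps) (auto simp: entire_def)
  then show "\<forall>r>0. summable (\<lambda>n. norm (fps_nth F n) * r ^ n)"
    by (auto simp: norm_mult norm_power)
next
  assume *: "\<forall>r>0. summable (\<lambda>n. norm (fps_nth F n) * r ^ n)"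
  have "fps_conv_radius F \<ge> ereal r" if "r > 0" for r
  proof -
    have "summable (\<lambda>n. norm (fps_nth F n * of_real r ^ n))"
      using * that by (auto simp: norm_mult norm_power)
    from summable_norm_cancel[OF this] show ?thesis
      unfolding fps_conv_radius_def using conv_radius_geI[of "fps_nth F" "of_real r"] that by simp
  qed
  then have "fps_conv_radius F \<ge> ereal r" for r
    by (meson ereal_less_eq(3) gt_ex less_le_not_le linorder_not_le order_trans)
  then show "entire F"
    unfolding entire_def by (simp add: ereal_top)
qed

lemma entire_const [simp]: "entire (fps_const c)"
  and entire_0 [simp]: "entire 0"
  and entire_1 [simp]: "entire 1"
  and entire_X [simp]: "entire fps_X"
  and entire_of_poly [simp]: "entire (fps_of_poly p)"
  by (simp_all add: entire_def)

lemma entire_uminus [simp]: "entire F \<Longrightarrow> entire (- F)"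
  by (simp add: entire_def)

lemma entire_add [simp]: "entire F \<Longrightarrow> entire G \<Longrightarrow> entire (F + G)"
  using fps_conv_radius_add[of F G] by (simp add: entire_def)

lemma entire_diff [simp]: "entire F \<Longrightarrow> entire G \<Longrightarrow> entire (F - G)"
  using fps_conv_radius_diff[of F G] by (simp add: entire_def)

lemma entire_mult [simp]: "entire F \<Longrightarrow> entire G \<Longrightarrow> entire (F * G)"
  using fps_conv_radius_mult[of F G] by (simp add: entire_def)

lemma entire_deriv [simp]: "entire F \<Longrightarrow> entire (fps_deriv F)"
  using fps_conv_radius_deriv[of F] by (simp add: entire_def)

lemma entire_sum: "(\<And>i. i \<in> I \<Longrightarrow> entire (F i)) \<Longrightarrow> entire (\<Sum>i\<in>I. F i)"
  by (induction I rule: infinite_finite_induct) auto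

lemma eval_entire [simp]:
  assumes "entire F" "entire G"
  shows "eval_fps (F + G) z = eval_fps F z + eval_fps G z"
    and "eval_fps (F - G) z = eval_fps F z - eval_fps G z"
    and "eval_fps (F * G) z = eval_fps F z * eval_fps G z"
  using assms by (auto simp: entire_def eval_fps_add eval_fps_diff eval_fps_mult)

lemma eval_entire_uminus [simp]: "entire F \<Longrightarrow> eval_fps (- F) z = - eval_fps F z"
  by (simp add: entire_def eval_fps_minus)

lemma eval_entire_sum:
  "(\<And>i. i \<in> I \<Longrightarrow> entire (F i)) \<Longrightarrow> eval_fps (\<Sum>i\<in>I. F i) z = (\<Sum>i\<in>I. eval_fps (F i) z)"
  by (induction I rule: infinite_finite_induct) (auto simp: entire_sum)

lemma entire_has_derivative:
  "entire F \<Longrightarrow> (eval_fps F has_field_derivative eval_fps (fps_deriv F) z) (at z within A)"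
  by (auto intro!: has_field_derivative_eval_fps simp: entire_def)

lemma entire_has_derivative' [derivative_intros]:
  assumes "entire F" "(g has_field_derivative g') (at z within A)"
  shows "((\<lambda>z. eval_fps F (g z)) has_field_derivative eval_fps (fps_deriv F) (g z) * g') (at z within A)"
  using DERIV_chain2[OF entire_has_derivative[OF assms(1)] assms(2)] .

lemma entire_has_derivative_square:
  "entire F \<Longrightarrow> ((\<lambda>x. eval_fps F (x\<^sup>2)) has_field_derivative eval_fps (fps_deriv F) (x\<^sup>2) * (2 * x)) (at x within A)"
  using entire_has_derivative'[of F "\<lambda>x. x\<^sup>2" "2 * x" x A] DERIV_power[OF DERIV_ident, of 2 x A] by simp

lemma entire_continuous_on: "entire F \<Longrightarrow> continuous_on A (eval_fps F)"
  by (rule continuous_on_eval_fps') (auto simp: entire_def)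

lemma entire_continuous_on_compose:
  "entire F \<Longrightarrow> continuous_on A f \<Longrightarrow> continuous_on A (\<lambda>x. eval_fps F (f x))"
  by (rule continuous_on_compose2[OF entire_continuous_on[of F UNIV]]) auto

lemma entire_continuous_on_square:
  "entire F \<Longrightarrow> continuous_on A (\<lambda>x. eval_fps F (x\<^sup>2))"
  using entire_continuous_on_compose[of F A "\<lambda>x. x\<^sup>2"] continuous_on_power[OF continuous_on_id, of A 2] by simp

lemma entire_isCont: "entire F \<Longrightarrow> isCont (eval_fps F) z"
  using entire_continuous_on[of F UNIV] by (simp add: continuous_on_eq_continuous_at)

lemma entire_sums: "entire F \<Longrightarrow> (\<lambda>n. fps_nth F n * z ^ n) sums eval_fps F z"
  by (rule sums_eval_fps) (auto simp: entire_def)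

lemma entire_summable_norm:
  fixes F :: "'a :: {banach, real_normed_field} fps"
  shows "entire F \<Longrightarrow> summable (\<lambda>n. norm (fps_nth F n))"
  using entire_iff_summable[of F] by (auto dest: spec[of _ 1])

text \<open>The l1 norm of the coefficients bounds the values on [0,1] and is easy to follow through
  powers of \<open>opT\<close>.\<close>

definition coeff_norm :: "real fps \<Rightarrow> real" where
  "coeff_norm F = (\<Sum>n. \<bar>fps_nth F n\<bar>)"

lemma coeff_norm_nonneg: "entire F \<Longrightarrow> 0 \<le> coeff_norm F"
  unfolding coeff_norm_def using entire_summable_norm[of F] by (intro suminf_nonneg) auto

lemma abs_eval_le_coeff_norm:
  assumes "entire F" "0 \<le> t" "t \<le> 1"
  shows "\<bar>eval_fps F t\<bar> \<le> coeff_norm F"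
proof -
  have s: "summable (\<lambda>n. \<bar>fps_nth F n\<bar>)"
    using entire_summable_norm[OF assms(1)] by simp
  have le: "\<bar>fps_nth F n * t ^ n\<bar> \<le> \<bar>fps_nth F n\<bar>" for n
    using assms by (simp add: abs_mult mult_left_le power_le_one)
  have s2: "summable (\<lambda>n. \<bar>fps_nth F n * t ^ n\<bar>)"
    by (rule summable_comparison_test_ev[OF _ s]) (use le in auto)
  have "\<bar>\<Sum>n. fps_nth F n * t ^ n\<bar> \<le> (\<Sum>n. \<bar>fps_nth F n * t ^ n\<bar>)"
    by (rule summable_rabs[OF s2])
  also have "\<dots> \<le> coeff_norm F"
    unfolding coeff_norm_def by (rule suminf_le[OF le s2 s])
  finally show ?thesis
    by (simp add: eval_fps_def)
qed

section \<open>The Bessel operator on power series\<close>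

locale bessel_index =
  fixes \<nu> :: real
  assumes nu: "\<nu> > -1"
begin

text \<open>Coefficients of the hypergeometric series 0F1(; \<nu>+1; -t): the Bessel function in the
  variable t = (x/2)^2, with the factor (x/2)^\<nu> / Gamma(\<nu>+1) removed.\<close>

definition \<tau> :: "nat \<Rightarrow> real" where
  "\<tau> m = (-1) ^ m / (fact m * pochhammer (\<nu> + 1) m)"

lemma \<tau>_0 [simp]: "\<tau> 0 = 1"
  by (simp add: \<tau>_def)

lemma den_pos [simp]: "real m + \<nu> + 1 > 0" "real m + \<nu> + 1 \<noteq> 0" "0 \<le> real m + \<nu> + 1"
    "\<bar>real m + \<nu> + 1\<bar> = real m + \<nu> + 1"
  using nu of_nat_0_le_iff[of m, where 'a = real] by linarith+

lemma \<tau>_Suc: "\<tau> (Suc m) = - \<tau> m / (real (Suc m) * (real m + \<nu> + 1))"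
  by (simp add: \<tau>_def pochhammer_Suc field_simps)

lemma abs_\<tau>_Suc: "\<bar>\<tau> (Suc m)\<bar> = \<bar>\<tau> m\<bar> / (real (Suc m) * (real m + \<nu> + 1))"
  using den_pos[of m] by (simp add: \<tau>_Suc abs_mult)

lemma sgn_\<tau>: "0 < (-1) ^ m * \<tau> m"
proof -
  have "pochhammer (\<nu> + 1) m > 0"
    using nu by (intro pochhammer_pos) auto
  then show ?thesis
    by (simp add: \<tau>_def flip: power_add mult.assoc power_mult_distrib)
qed

text \<open>In the variable \<open>t = x\<^sup>2\<close> the Bessel operator \<open>- x\<^sup>-\<^sup>2\<^sup>\<nu>\<^sup>-\<^sup>1 (x\<^sup>2\<^sup>\<nu>\<^sup>+\<^sup>1 f')'\<close> is \<open>4 opA\<close>; its eigenfunctions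
  regular at 0 are \<open>eigen w\<close>, with \<open>w = \<lambda>\<^sup>2 / 4\<close> for the frequency \<open>\<lambda>\<close>.\<close>

definition opA :: "real fps \<Rightarrow> real fps" where
  "opA F = - (fps_X * fps_deriv (fps_deriv F) + fps_const (\<nu> + 1) * fps_deriv F)"

lemma opA_nth: "fps_nth (opA F) m = - (real (Suc m) * (real m + \<nu> + 1) * fps_nth F (Suc m))"
  by (cases m) (auto simp: opA_def algebra_simps)

lemma entire_opA [simp]: "entire F \<Longrightarrow> entire (opA F)"
  by (simp add: opA_def)

lemma opA_diff: "opA (F - G) = opA F - opA G"
  by (intro fps_ext) (simp add: opA_nth algebra_simps)

lemma opA_mult_const: "opA (fps_const c * F) = fps_const c * opA F"
  by (intro fps_ext) (simp add: opA_nth algebra_simps)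

lemma opA_const [simp]: "opA (fps_const c) = 0"
  by (intro fps_ext) (simp add: opA_nth)

lemma opA_sum: "opA (\<Sum>i\<in>I. F i) = (\<Sum>i\<in>I. opA (F i))"
  by (intro fps_ext) (simp add: opA_nth fps_sum_nth sum_distrib_left sum_negf)

definition eigen :: "real \<Rightarrow> real fps" where
  "eigen w = Abs_fps (\<lambda>m. \<tau> m * w ^ m)"

text \<open>Polymorphic in the scalars: real values enter the eigenfunctions, complex ones the
  quotient of entire functions of the spectral parameter.\<close>

definition bess :: "'a :: {banach, real_normed_field} fps" where
  "bess = Abs_fps (\<lambda>m. of_real (\<tau> m))"

lemma bess_nth: "fps_nth bess m = of_real (\<tau> m)"
  by (simp add: bess_def)

lemma summable_\<tau>: "summable (\<lambda>m. \<bar>\<tau> m\<bar> * r ^ m)"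
proof (cases "r = 0")
  case False
  \<comment> \<open>The factor real m + \<nu> + 1 alone exceeds 2 |r| here, because \<nu> >
    -1.\<close>
  have N: "\<bar>r\<bar> / (real (Suc m) * (real m + \<nu> + 1)) < 1/2" if m: "m \<ge> nat \<lceil>2 * \<bar>r\<bar> + 1\<rceil>" for m
  proof -
    have m': "2 * \<bar>r\<bar> + 1 \<le> real m"
      using m by linarith
    have "1 * (2 * \<bar>r\<bar>) < real (Suc m) * (real m + \<nu> + 1)"
      using m' nu by (intro mult_strict_mono') auto
    then show ?thesis
      by (simp add: divide_less_eq)
  qed
  show ?thesis
  proof (rule summable_ratio_test[of "1/2" "nat \<lceil>2 * \<bar>r\<bar> + 1\<rceil>"])
    fix n assume n: "n \<ge> nat \<lceil>2 * \<bar>r\<bar> + 1\<rceil>"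
    have "norm (\<bar>\<tau> (Suc n)\<bar> * r ^ Suc n) = (\<bar>r\<bar> / (real (Suc n) * (real n + \<nu> + 1))) * norm (\<bar>\<tau> n\<bar> * r ^ n)"
      by (simp only: abs_\<tau>_Suc) (simp add: abs_mult power_abs)
    also have "\<dots> \<le> 1/2 * norm (\<bar>\<tau> n\<bar> * r ^ n)"
      by (intro mult_right_mono less_imp_le[OF N] n) auto
    finally show "norm (\<bar>\<tau> (Suc n)\<bar> * r ^ Suc n) \<le> 1/2 * norm (\<bar>\<tau> n\<bar> * r ^ n)" .
  qed auto
qed (auto intro: summable_finite[of "{0}"])

lemma entire_bess [simp]: "entire bess"
  unfolding entire_iff_summable by (auto simp: bess_def summable_\<tau>)

lemma entire_eigen [simp]: "entire (eigen w)"
  unfolding entire_iff_summable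
proof (intro allI impI)
  fix r :: real
  have "summable (\<lambda>m. \<bar>\<tau> m\<bar> * (\<bar>w\<bar> * r) ^ m)"
    by (rule summable_\<tau>)
  then show "summable (\<lambda>n. norm (fps_nth (eigen w) n) * r ^ n)"
    by (simp add: eigen_def abs_mult power_abs power_mult_distrib mult.assoc)
qed

lemma eval_eigen: "eval_fps (eigen w) t = eval_fps bess (w * t)"
  by (simp add: eval_fps_def eigen_def bess_def power_mult_distrib mult.assoc)

lemma eval_eigen_0 [simp]: "eval_fps (eigen w) 0 = 1"
  by (simp add: eval_fps_at_0 eigen_def)

lemma eval_bess_of_real: "eval_fps bess (of_real x) = (of_real (eval_fps bess x) :: complex)"
proof -
  have "(\<lambda>n. of_real (fps_nth bess n * x ^ n)) sums (of_real (eval_fps bess x) :: complex)"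
    by (intro sums_of_real entire_sums) auto
  moreover have "(\<lambda>n. fps_nth bess n * of_real x ^ n) sums (eval_fps bess (of_real x) :: complex)"
    by (intro entire_sums) auto
  ultimately show ?thesis
    by (simp add: bess_def sums_unique2)
qed

lemma opA_eigen: "opA (eigen w) = fps_const w * eigen w"
proof (rule fps_ext)
  fix m
  have "real (Suc m) * (real m + \<nu> + 1) \<noteq> 0"
    by simp
  then show "fps_nth (opA (eigen w)) m = fps_nth (fps_const w * eigen w) m"
    by (simp add: opA_nth eigen_def \<tau>_Suc)
qed

text \<open>The right inverse of \<open>opA\<close> whose values vanish at the origin.\<close>

definition opT :: "real fps \<Rightarrow> real fps" where
  "opT g = Abs_fps (\<lambda>n. case n of 0 \<Rightarrow> 0 | Suc m \<Rightarrow> - fps_nth g m / (real (Suc m) * (real m + \<nu> + 1)))"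

lemma opT_nth_0 [simp]: "fps_nth (opT g) 0 = 0"
  and opT_nth_Suc: "fps_nth (opT g) (Suc m) = - fps_nth g m / (real (Suc m) * (real m + \<nu> + 1))"
  by (simp_all add: opT_def)

lemma opA_opT: "opA (opT g) = g"
proof (rule fps_ext)
  fix m
  have "real (Suc m) * (real m + \<nu> + 1) \<noteq> 0"
    by simp
  then show "fps_nth (opA (opT g)) m = fps_nth g m"
    by (simp add: opA_nth opT_nth_Suc)
qed

text \<open>The kernel of \<open>opA\<close> consists of the constants, so only the value at 0 is
  lost.\<close>

lemma opT_opA: "opT (opA F) = F - fps_const (fps_nth F 0)"
proof (rule fps_ext)
  fix m show "fps_nth (opT (opA F)) m = fps_nth (F - fps_const (fps_nth F 0)) m"
  proof (cases m)
    case (Suc k)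
    have "real (Suc k) * (real k + \<nu> + 1) \<noteq> 0"
      using den_pos(2)[of k] by simp
    then show ?thesis
      using Suc by (simp add: opA_nth opT_nth_Suc)
  qed simp
qed

lemma opT_diff: "opT (F - G) = opT F - opT G"
  by (rule fps_ext) (simp add: opT_def diff_divide_distrib split: nat.split)

lemma opT_mult_const: "opT (fps_const c * F) = fps_const c * opT F"
  by (rule fps_ext) (simp add: opT_def split: nat.split)

lemma opT_sum: "opT (\<Sum>i\<in>I. F i) = (\<Sum>i\<in>I. opT (F i))"
  by (rule fps_ext) (simp add: opT_def fps_sum_nth sum_divide_distrib sum_negf split: nat.split)

lemma opT_pow_nth_less: "n < k \<Longrightarrow> fps_nth ((opT ^^ k) g) n = 0"
proof (induction k arbitrary: n)
  case (Suc k)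
  then show ?case by (cases n) (auto simp: opT_nth_Suc)
qed simp

text \<open>Each application divides by a denominator that grows with the degree; the smallest ones,
  met by the constant term, multiply up to 1 / |\<tau> k|.\<close>

lemma abs_opT_pow_nth_le: "\<bar>fps_nth ((opT ^^ k) g) (n + k)\<bar> \<le> \<bar>\<tau> k\<bar> * \<bar>fps_nth g n\<bar>"
proof (induction k)
  case (Suc k)
  have pos: "0 < real (Suc k) * (real k + \<nu> + 1)"
    by (intro mult_pos_pos) auto
  have le: "real (Suc k) * (real k + \<nu> + 1) \<le> real (Suc (n + k)) * (real (n + k) + \<nu> + 1)"
    using den_pos(1)[of k] by (intro mult_mono) auto
  have "\<bar>fps_nth ((opT ^^ Suc k) g) (n + Suc k)\<bar> =
      \<bar>fps_nth ((opT ^^ k) g) (n + k)\<bar> / \<bar>real (Suc (n + k)) * (real (n + k) + \<nu> + 1)\<bar>"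
    by (simp add: opT_nth_Suc del: of_nat_Suc of_nat_add)
  also have "\<dots> = \<bar>fps_nth ((opT ^^ k) g) (n + k)\<bar> / (real (Suc (n + k)) * (real (n + k) + \<nu> + 1))"
    using pos le by (simp only: abs_of_pos)
  also have "\<dots> \<le> (\<bar>\<tau> k\<bar> * \<bar>fps_nth g n\<bar>) / (real (Suc k) * (real k + \<nu> + 1))"
    by (intro frac_le Suc pos le) auto
  finally show ?case
    by (simp add: abs_\<tau>_Suc)
qed simp

text \<open>At t = 1 these monomials give the coefficients of \<open>bess\<close>, which is how the
  Bessel function enters the powers of the Dirichlet inverse.\<close>

lemma opT_pow_1: "(opT ^^ k) 1 = fps_const (\<tau> k) * fps_X ^ k"
proof (induction k)
  case (Suc k)
  show ?case
  proof (rule fps_ext)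
    fix n show "fps_nth ((opT ^^ Suc k) 1) n = fps_nth (fps_const (\<tau> (Suc k)) * fps_X ^ Suc k) n"
      by (cases n) (auto simp: Suc opT_nth_Suc \<tau>_Suc fps_X_power_nth simp del: power_Suc of_nat_Suc)
  qed
qed simp

lemma summable_opT_pow:
  assumes "entire g" "0 < r"
  shows "summable (\<lambda>n. \<bar>fps_nth ((opT ^^ k) g) n\<bar> * r ^ n)"
proof -
  have "summable (\<lambda>n. \<bar>\<tau> k\<bar> * r ^ k * (norm (fps_nth g n) * r ^ n))"
    using assms by (intro summable_mult) (auto simp: entire_iff_summable)
  then have "summable (\<lambda>n. \<bar>fps_nth ((opT ^^ k) g) (n + k)\<bar> * r ^ (n + k))"
  proof (rule summable_comparison_test_ev[rotated])
    show "\<forall>\<^sub>F n in sequentially. norm (\<bar>fps_nth ((opT ^^ k) g) (n + k)\<bar> * r ^ (n + k))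
        \<le> \<bar>\<tau> k\<bar> * r ^ k * (norm (fps_nth g n) * r ^ n)"
      using abs_opT_pow_nth_le[of k g] assms
      by (intro always_eventually allI) (auto simp: power_add abs_mult mult_ac)
  qed
  then show ?thesis
    by (subst (asm) summable_iff_shift)
qed

lemma entire_opT_pow [simp]: "entire g \<Longrightarrow> entire ((opT ^^ k) g)"
  using summable_opT_pow[of g] by (subst entire_iff_summable) auto

lemma entire_opT [simp]: "entire g \<Longrightarrow> entire (opT g)"
  using entire_opT_pow[of g 1] by simp

lemma coeff_norm_opT_pow:
  assumes "entire g"
  shows "coeff_norm ((opT ^^ k) g) \<le> \<bar>\<tau> k\<bar> * coeff_norm g"
proof -
  have s: "summable (\<lambda>n. \<bar>fps_nth ((opT ^^ k) g) n\<bar>)" "summable (\<lambda>n. \<bar>fps_nth g n\<bar>)"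
    using entire_summable_norm[of "(opT ^^ k) g"] entire_summable_norm[of g] assms by auto
  have "coeff_norm ((opT ^^ k) g) = (\<Sum>n. \<bar>fps_nth ((opT ^^ k) g) (n + k)\<bar>)"
    unfolding coeff_norm_def using suminf_split_initial_segment[OF s(1), of k]
    by (simp add: opT_pow_nth_less)
  also have "\<dots> \<le> (\<Sum>n. \<bar>\<tau> k\<bar> * \<bar>fps_nth g n\<bar>)"
    by (intro suminf_le abs_opT_pow_nth_le summable_mult s(2)) (use s(1) in \<open>simp only: summable_iff_shift[of "\<lambda>n. \<bar>fps_nth ((opT ^^ k) g) n\<bar>"]\<close>)
  also have "\<dots> = \<bar>\<tau> k\<bar> * coeff_norm g"
    unfolding coeff_norm_def by (rule suminf_mult[OF s(2)])
  finally show ?thesis .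
qed

lemma abs_eval_opT_pow_le:
  assumes "entire g" "0 \<le> t" "t \<le> 1"
  shows "\<bar>eval_fps ((opT ^^ k) g) t\<bar> \<le> \<bar>\<tau> k\<bar> * coeff_norm g"
  using abs_eval_le_coeff_norm[of "(opT ^^ k) g" t] coeff_norm_opT_pow[of g k] assms by simp

end

section \<open>Weighted integrals and Green's identity\<close>

lemma unit_interval_space [simp]: "space unit_measure = {0<..<1}"
  by (simp add: unit_measure_def space_restrict_space)

lemma sets_unit_measure: "sets unit_measure = sets (restrict_space borel {0<..<1})"
  by (simp add: unit_measure_def sets_restrict_space)

lemma measurable_unit_measureI:
  "f \<in> borel_measurable borel \<Longrightarrow> f \<in> borel_measurable unit_measure"
  by (simp add: unit_measure_def measurable_restrict_space1)

lemma finite_unit_measure: "finite_measure unit_measure"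
  by standard (simp add: unit_measure_def emeasure_restrict_space space_restrict_space)

lemma einterval_unit: "einterval (ereal 0) (ereal 1) = {0<..<1::real}"
  by (auto simp: einterval_def)

text \<open>For a nonnegative integrand, integrability follows from the limits of the antiderivative
  at both ends. This serves the integrand of Picone's identity, whose denominator vanishes at
  1.\<close>

lemma unit_FTC_nonneg:
  fixes f F :: "real \<Rightarrow> real"
  assumes "\<And>x. 0 < x \<Longrightarrow> x < 1 \<Longrightarrow> (F has_real_derivative f x) (at x)"
    and "\<And>x. 0 < x \<Longrightarrow> x < 1 \<Longrightarrow> isCont f x"
    and "\<And>x. 0 < x \<Longrightarrow> x < 1 \<Longrightarrow> 0 \<le> f x"
    and "(F \<longlongrightarrow> A) (at_right 0)" "(F \<longlongrightarrow> B) (at_left 1)"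
  shows "integrable unit_measure f" "(\<integral>x. f x \<partial>unit_measure) = B - A"
proof -
  have lim: "((F \<circ> real_of_ereal) \<longlongrightarrow> A) (at_right (ereal 0))"
    "((F \<circ> real_of_ereal) \<longlongrightarrow> B) (at_left (ereal 1))"
    using assms(4,5) by (simp_all only: ereal_tendsto_simps1)
  have "set_integrable lborel (einterval (ereal 0) (ereal 1)) f"
    by (rule interval_integral_FTC_nonneg(1)[OF _ _ _ _ lim]) (use assms(1-3) in auto)
  moreover have "(LBINT x=ereal 0..ereal 1. f x) = B - A"
    by (rule interval_integral_FTC_nonneg(2)[OF _ _ _ _ lim]) (use assms(1-3) in auto)
  ultimately have "set_integrable lborel (einterval (ereal 0) (ereal 1)) f"
    "(LBINT x=ereal 0..ereal 1. f x) = B - A"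
    by blast+
  then show "integrable unit_measure f" "(\<integral>x. f x \<partial>unit_measure) = B - A"
    unfolding einterval_unit interval_lebesgue_integral_def unit_measure_def
    by (auto simp: integrable_restrict_space integral_restrict_space set_integrable_def
      set_lebesgue_integral_def)
qed

lemma unit_FTC_integrable:
  fixes f F :: "real \<Rightarrow> real"
  assumes "\<And>x. 0 < x \<Longrightarrow> x < 1 \<Longrightarrow> (F has_real_derivative f x) (at x)"
    and "\<And>x. 0 < x \<Longrightarrow> x < 1 \<Longrightarrow> isCont f x"
    and "integrable unit_measure f"
    and "(F \<longlongrightarrow> A) (at_right 0)" "(F \<longlongrightarrow> B) (at_left 1)"
  shows "(\<integral>x. f x \<partial>unit_measure) = B - A"
proof -
  have lim: "((F \<circ> real_of_ereal) \<longlongrightarrow> A) (at_right (ereal 0))"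
    "((F \<circ> real_of_ereal) \<longlongrightarrow> B) (at_left (ereal 1))"
    using assms(4,5) by (simp_all only: ereal_tendsto_simps1)
  have "set_integrable lborel {0<..<1} f"
    using assms(3) by (simp add: unit_measure_def integrable_restrict_space set_integrable_def)
  then have "(LBINT x=ereal 0..ereal 1. f x) = B - A"
    by (intro interval_integral_FTC_integrable[OF _ _ _ _ lim])
       (use assms(1,2) in \<open>auto simp: einterval_unit simp flip: has_real_derivative_iff_has_vector_derivative\<close>)
  then show ?thesis
    unfolding einterval_unit interval_lebesgue_integral_def unit_measure_def
    by (auto simp: integral_restrict_space set_lebesgue_integral_def)
qed

lemma integrable_unit_powr:
  assumes "a > -1"
  shows "integrable unit_measure (\<lambda>x. x powr a)"
proof -
  have p: "x powr (a + 1) = x * x powr a" if "x > 0" for x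
    using that by (simp add: powr_add)
  have "((\<lambda>x. x powr (a + 1)) \<longlongrightarrow> 0) (at_right (0 :: real))"
    using assms by (auto intro!: tendsto_eq_intros eventually_at_rightI[of 0 1])
  moreover have "((\<lambda>x. x powr (a + 1)) \<longlongrightarrow> 1) (at_left (1 :: real))"
    by (auto intro!: tendsto_eq_intros)
  ultimately have "integrable unit_measure (\<lambda>x. (a + 1) * x powr a)"
    by (intro unit_FTC_nonneg[where F = "\<lambda>x. x powr (a + 1)"])
      (use assms in \<open>auto intro!: derivative_eq_intros continuous_intros simp: p\<close>)
  then show ?thesis
    using assms by (simp add: integrable_mult_left_iff add_eq_0_iff)
qed

lemma isCont_powr_times_entire:
  fixes S :: "real fps"
  assumes "x > 0" "entire S"
  shows "isCont (\<lambda>x. x powr a * eval_fps S (x\<^sup>2)) x"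
  by (rule DERIV_isCont, rule DERIV_mult[OF has_real_derivative_powr entire_has_derivative_square]) fact+

lemma integrable_unit_powr_times:
  fixes g :: "real \<Rightarrow> real"
  assumes "a > -1" "g \<in> borel_measurable borel" "continuous_on {0..1} g"
  shows "integrable unit_measure (\<lambda>x. x powr a * g x)"
proof -
  have "compact (g ` {0..1})"
    by (intro compact_continuous_image assms) auto
  then obtain B where B: "\<And>x. x \<in> {0..1} \<Longrightarrow> \<bar>g x\<bar> \<le> B"
    using compact_imp_bounded[of "g ` {0..1}"] unfolding bounded_iff
    by (metis imageI real_norm_def)
  have "integrable unit_measure (\<lambda>x. B * x powr a)"
    using integrable_unit_powr[OF assms(1)] by simp
  then show ?thesis
  proof (rule Bochner_Integration.integrable_bound)
    show "AE x in unit_measure. norm (x powr a * g x) \<le> norm (B * x powr a)"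
    proof (rule AE_I2)
      fix x assume "x \<in> space unit_measure"
      then have "\<bar>g x\<bar> \<le> \<bar>B\<bar>"
        using B[of x] by auto
      then show "norm (x powr a * g x) \<le> norm (B * x powr a)"
        by (simp add: abs_mult mult_right_mono mult.commute[of "x powr a"])
    qed
    show "(\<lambda>x. x powr a * g x) \<in> borel_measurable unit_measure"
      using assms(2) by (intro measurable_unit_measureI) measurable
  qed
qed

text \<open>The points of (0,1) where g is nonzero form an open null set, hence none exist; the
  endpoints follow by continuity.\<close>

lemma AE_unit_zero_continuous:
  fixes g :: "real \<Rightarrow> real"
  assumes "continuous_on UNIV g" "AE x in unit_measure. g x = 0" "t \<in> {0..1}"
  shows "g t = 0"
proof -
  define U where "U = {x \<in> {0<..<1}. g x \<noteq> 0}"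
  have "open ({0<..<1} \<inter> g -` (- {0}))"
    by (intro continuous_open_preimage continuous_on_subset[OF assms(1)]) auto
  moreover have "{0<..<1} \<inter> g -` (- {0}) = U"
    by (auto simp: U_def)
  ultimately have "open U"
    by simp
  have "AE x in lborel. x \<notin> U"
    using assms(2) unfolding unit_measure_def
    by (subst (asm) AE_restrict_space_iff) (auto simp: U_def elim: eventually_mono)
  then have "U \<in> null_sets lborel"
    using \<open>open U\<close> by (subst (asm) AE_iff_null_sets[symmetric]) auto
  then have "negligible U"
    by (simp add: negligible_iff_null_sets null_sets_completionI)
  then have "U = {}"
    using open_not_negligible[OF \<open>open U\<close>] by blast
  then have "g x = 0" if "x \<in> {0<..<1}" for x
    using that by (auto simp: U_def)
  moreover have "continuous_on (closure {0<..<1}) g"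
    by (rule continuous_on_subset[OF assms(1)]) simp
  ultimately show ?thesis
    using continuous_constant_on_closure[of "{0<..<1}" g 0 t] assms(3) by simp
qed

section \<open>The weighted inner product of even functions\<close>

context bessel_index
begin

text \<open>Only the series lives in the variable t = x^2; the integral stays in x, so no
  substitution under the integral is required.\<close>

definition wint :: "real fps \<Rightarrow> real" where
  "wint S = (\<integral>x. x powr (2 * \<nu> + 1) * eval_fps S (x\<^sup>2) \<partial>unit_measure)"

lemma wint_integrable:
  assumes "entire S"
  shows "integrable unit_measure (\<lambda>x. x powr (2 * \<nu> + 1) * eval_fps S (x\<^sup>2))"
proof -
  show ?thesis
  proof (rule integrable_unit_powr_times)
    show "continuous_on {0..1} (\<lambda>x. eval_fps S (x\<^sup>2))"
      by (rule entire_continuous_on_square[OF assms])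
    show "(\<lambda>x. eval_fps S (x\<^sup>2)) \<in> borel_measurable borel"
      by (intro borel_measurable_continuous_onI entire_continuous_on_square assms)
  qed (use nu in simp)
qed

lemma wint_add: "entire F \<Longrightarrow> entire G \<Longrightarrow> wint (F + G) = wint F + wint G"
  by (simp add: wint_def distrib_left Bochner_Integration.integral_add wint_integrable)

lemma wint_diff: "entire F \<Longrightarrow> entire G \<Longrightarrow> wint (F - G) = wint F - wint G"
  by (simp add: wint_def right_diff_distrib Bochner_Integration.integral_diff wint_integrable)

lemma wint_cmult:
  assumes "entire F"
  shows "wint (fps_const c * F) = c * wint F"
proof -
  have "(\<lambda>x. x powr (2 * \<nu> + 1) * eval_fps (fps_const c * F) (x\<^sup>2)) =
      (\<lambda>x. c * (x powr (2 * \<nu> + 1) * eval_fps F (x\<^sup>2)))"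
    using assms by (auto simp: fun_eq_iff)
  then show ?thesis
    by (simp add: wint_def)
qed

lemma wint_0 [simp]: "wint 0 = 0"
  by (simp add: wint_def)

text \<open>The boundary term at 0 disappears because the exponent 2\<nu>+2 is positive.\<close>

lemma wint_antiderivative:
  assumes "entire P"
  shows "\<And>x. x > 0 \<Longrightarrow> ((\<lambda>x. x powr (2 * \<nu> + 2) * eval_fps P (x\<^sup>2)) has_real_derivative
      2 * (x powr (2 * \<nu> + 1) * eval_fps (fps_const (\<nu> + 1) * P + fps_X * fps_deriv P) (x\<^sup>2))) (at x)"
    and "((\<lambda>x. x powr (2 * \<nu> + 2) * eval_fps P (x\<^sup>2)) \<longlongrightarrow> 0) (at_right 0)"
    and "((\<lambda>x. x powr (2 * \<nu> + 2) * eval_fps P (x\<^sup>2)) \<longlongrightarrow> eval_fps P 1) (at_left 1)"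
proof -
  have lim: "((\<lambda>x. eval_fps P (x\<^sup>2)) \<longlongrightarrow> eval_fps P (a\<^sup>2)) (at a within A)" for a A
    by (intro isCont_tendsto_compose[OF entire_isCont[OF assms]] tendsto_intros)
  have "((\<lambda>x. x powr (2 * \<nu> + 2)) \<longlongrightarrow> 0) (at_right (0 :: real))"
    using nu by (auto intro!: tendsto_eq_intros eventually_at_rightI[of 0 1])
  from tendsto_mult[OF this lim[of 0 "{0<..}"]]
  show "((\<lambda>x. x powr (2 * \<nu> + 2) * eval_fps P (x\<^sup>2)) \<longlongrightarrow> 0) (at_right 0)"
    by simp
  have "((\<lambda>x. x powr (2 * \<nu> + 2)) \<longlongrightarrow> 1) (at_left (1 :: real))"
    by (auto intro!: tendsto_eq_intros)
  from tendsto_mult[OF this lim[of 1 "{..<1}"]]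
  show "((\<lambda>x. x powr (2 * \<nu> + 2) * eval_fps P (x\<^sup>2)) \<longlongrightarrow> eval_fps P 1) (at_left 1)"
    by simp
  fix x :: real assume "x > 0"
  have p: "x powr (2 * \<nu> + 2) = x * x powr (2 * \<nu> + 1)"
  proof -
    have e: "2 * \<nu> + 2 = 1 + (2 * \<nu> + 1)"
      by simp
    show ?thesis
      unfolding e powr_add using \<open>x > 0\<close> by simp
  qed
  show "((\<lambda>x. x powr (2 * \<nu> + 2) * eval_fps P (x\<^sup>2)) has_real_derivative
      2 * (x powr (2 * \<nu> + 1) * eval_fps (fps_const (\<nu> + 1) * P + fps_X * fps_deriv P) (x\<^sup>2))) (at x)"
  proof (rule DERIV_cong[OF DERIV_mult[OF has_real_derivative_powr[OF \<open>x > 0\<close>] entire_has_derivative_square[OF assms]]])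
    show "(2 * \<nu> + 2) * x powr (2 * \<nu> + 2 - 1) * eval_fps P (x\<^sup>2)
        + eval_fps (fps_deriv P) (x\<^sup>2) * (2 * x) * x powr (2 * \<nu> + 2)
      = 2 * (x powr (2 * \<nu> + 1) * eval_fps (fps_const (\<nu> + 1) * P + fps_X * fps_deriv P) (x\<^sup>2))"
      using assms p by (simp add: algebra_simps power2_eq_square)
  qed
qed

lemma wint_exact:
  assumes "entire P"
  shows "wint (fps_const (\<nu> + 1) * P + fps_X * fps_deriv P) = eval_fps P 1 / 2"
proof -
  let ?S = "fps_const (\<nu> + 1) * P + fps_X * fps_deriv P"
  have S: "entire ?S"
    using assms by simp
  have "(\<integral>x. 2 * (x powr (2 * \<nu> + 1) * eval_fps ?S (x\<^sup>2)) \<partial>unit_measure) = eval_fps P 1 - 0"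
  proof (rule unit_FTC_integrable[OF _ _ _ wint_antiderivative(2,3)[OF assms]])
    show "integrable unit_measure (\<lambda>x. 2 * (x powr (2 * \<nu> + 1) * eval_fps ?S (x\<^sup>2)))"
      by (intro integrable_mult_right wint_integrable S)
    show "isCont (\<lambda>x. 2 * (x powr (2 * \<nu> + 1) * eval_fps ?S (x\<^sup>2))) x" if "0 < x" for x
      using that by (intro continuous_mult[OF continuous_const] isCont_powr_times_entire S)
  qed (use wint_antiderivative(1)[OF assms] in auto)
  then show ?thesis
    by (simp add: wint_def)
qed

definition ip :: "real fps \<Rightarrow> real fps \<Rightarrow> real" where
  "ip F G = wint (F * G)"

lemma ip_commute: "ip F G = ip G F"
  by (simp add: ip_def mult.commute)

lemma ip_diff_left: "entire F \<Longrightarrow> entire G \<Longrightarrow> entire H \<Longrightarrow> ip (F - G) H = ip F H - ip G H"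
  by (simp add: ip_def left_diff_distrib wint_diff)

lemma ip_diff_right: "entire F \<Longrightarrow> entire G \<Longrightarrow> entire H \<Longrightarrow> ip H (F - G) = ip H F - ip H G"
  by (simp add: ip_def right_diff_distrib wint_diff)

lemma ip_cmult_left: "entire F \<Longrightarrow> entire G \<Longrightarrow> ip (fps_const c * F) G = c * ip F G"
  by (simp add: ip_def mult.assoc wint_cmult)

lemma ip_cmult_right: "entire F \<Longrightarrow> entire G \<Longrightarrow> ip F (fps_const c * G) = c * ip F G"
  by (simp only: ip_def mult.left_commute[of F] wint_cmult entire_mult)

lemma ip_sum_left:
  "(\<And>i. i \<in> I \<Longrightarrow> entire (F i)) \<Longrightarrow> entire G \<Longrightarrow> ip (\<Sum>i\<in>I. F i) G = (\<Sum>i\<in>I. ip (F i) G)"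
  by (induction I rule: infinite_finite_induct)
    (auto simp: ip_def distrib_right wint_add entire_sum)

lemma ip_self_nonneg: "entire F \<Longrightarrow> 0 \<le> ip F F"
  unfolding ip_def wint_def by (intro Bochner_Integration.integral_nonneg) auto

lemma ip_self_eq_0_imp:
  assumes "entire F" "ip F F = 0" "t \<in> {0..1}"
  shows "eval_fps F t = 0"
proof -
  have "AE x in unit_measure. x powr (2 * \<nu> + 1) * eval_fps (F * F) (x\<^sup>2) = 0"
    using assms(1,2) wint_integrable[of "F * F"]
    by (subst integral_nonneg_eq_0_iff_AE[symmetric]) (auto simp: ip_def wint_def)
  moreover have "AE x in unit_measure. x \<noteq> 0"
    by (rule AE_I2) auto
  ultimately have "AE x in unit_measure. eval_fps F (x\<^sup>2) = 0"
    by eventually_elim (use assms(1) in auto)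
  moreover have "continuous_on UNIV (\<lambda>x. eval_fps F (x\<^sup>2))"
    by (rule entire_continuous_on_square[OF assms(1)])
  \<comment> \<open>The point t of the squared variable is reached from x = sqrt t.\<close>
  ultimately have "eval_fps F ((sqrt t)\<^sup>2) = 0"
    using AE_unit_zero_continuous[of "\<lambda>x. eval_fps F (x\<^sup>2)" "sqrt t"] assms(3) by simp
  then show ?thesis
    using assms(3) by simp
qed

lemma ip_self_pos: "entire F \<Longrightarrow> t \<in> {0..1} \<Longrightarrow> eval_fps F t \<noteq> 0 \<Longrightarrow> 0 < ip F F"
  using ip_self_nonneg[of F] ip_self_eq_0_imp[of F t] by (cases "ip F F = 0") auto

lemma ip_Cauchy_Schwarz:
  assumes [simp]: "entire F" "entire G"
  shows "(ip F G)\<^sup>2 \<le> ip F F * ip G G"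
proof (cases "ip G G = 0")
  case True
  then have "eval_fps (F * G) (x\<^sup>2) = 0" if "x \<in> space unit_measure" for x
    using that ip_self_eq_0_imp[of G "x\<^sup>2"] by (auto simp: power_le_one)
  then have "ip F G = 0"
    unfolding ip_def wint_def by (intro integral_eq_zero_AE AE_I2) auto
  then show ?thesis
    by (simp add: True)
next
  case False
  \<comment> \<open>c G is the orthogonal projection of F onto the line through G, so the squared
    norm of F - c G is the deficit in the inequality.\<close>
  define c where "c = ip F G / ip G G"
  have "0 \<le> ip (F - fps_const c * G) (F - fps_const c * G)"
    by (rule ip_self_nonneg) simp
  also have "\<dots> = ip F F - 2 * c * ip F G + c * (c * ip G G)"
    by (simp add: ip_diff_left ip_diff_right ip_cmult_left ip_cmult_right ip_commute[of G F] right_diff_distrib)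
  also have "\<dots> = ip F F - (ip F G)\<^sup>2 / ip G G"
    using False by (simp add: c_def field_simps power2_eq_square)
  finally show ?thesis
    using False ip_self_nonneg[of G] by (simp add: field_simps)
qed

text \<open>The difference of the two integrands is (\<nu>+1) P + t P' for the Wronskian P = F G' -
  F' G, hence exact, and only the boundary term at 1 survives.\<close>

lemma Green:
  assumes [simp]: "entire F" "entire G"
  shows "ip (opA F) G - ip F (opA G) =
    (eval_fps F 1 * eval_fps (fps_deriv G) 1 - eval_fps (fps_deriv F) 1 * eval_fps G 1) / 2"
proof -
  define P where "P = F * fps_deriv G - fps_deriv F * G"
  define c where "c = fps_const (\<nu> + 1)"
  have "opA F * G - F * opA G = c * P + fps_X * fps_deriv P"
    unfolding opA_def P_def c_def[symmetric] fps_deriv_sub fps_deriv_mult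
    by algebra
  then have "ip (opA F) G - ip F (opA G) = wint (c * P + fps_X * fps_deriv P)"
    by (subst (asm) eq_commute) (simp only: ip_def wint_diff entire_mult entire_opA assms)
  also have "\<dots> = eval_fps P 1 / 2"
    unfolding c_def by (rule wint_exact) (simp add: P_def)
  finally show ?thesis
    by (simp add: P_def)
qed

lemma opA_symmetric:
  assumes "entire F" "entire G" "eval_fps F 1 = 0" "eval_fps G 1 = 0"
  shows "ip (opA F) G = ip F (opA G)"
  using Green[OF assms(1,2)] assms(3,4) by simp

end

section \<open>Zeros of the Bessel function\<close>

text \<open>Log-convexity makes the ratios of consecutive terms nondecreasing. Were the first ratio
  q larger than \<rho>, s would grow at least like q^k, against the bound.\<close>

lemma log_convex_ratio_le:
  fixes s :: "nat \<Rightarrow> real"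
  assumes nn: "\<And>k. 0 \<le> s k" and conv: "\<And>k. (s (Suc k))\<^sup>2 \<le> s k * s (Suc (Suc k))"
    and bound: "\<And>k. s k \<le> C * \<rho> ^ k" and "\<rho> > 0"
  shows "s 1 \<le> \<rho> * s 0"
proof (rule ccontr)
  assume "\<not> s 1 \<le> \<rho> * s 0"
  then have gt: "\<rho> * s 0 < s 1"
    by simp
  have s1: "s 1 > 0"
    using gt nn[of 0] \<open>\<rho> > 0\<close> by (meson le_less_trans mult_nonneg_nonneg less_imp_le)
  have s0: "s 0 > 0"
    using conv[of 0] nn[of 0] s1 by (cases "s 0 = 0") auto
  define q where "q = s 1 / s 0"
  have q: "q > \<rho>"
    using gt s0 by (simp add: q_def field_simps)
  have step: "0 < s k \<and> q * s k \<le> s (Suc k)" for k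
  proof (induction k)
    case (Suc k)
    have pos: "0 < s (Suc k)"
      using Suc q \<open>\<rho> > 0\<close> by (meson less_le_trans mult_pos_pos order_less_trans)
    have "q * s k * s (Suc k) \<le> s (Suc k) * s (Suc k)"
      using Suc pos by (intro mult_right_mono) auto
    also have "\<dots> \<le> s k * s (Suc (Suc k))"
      using conv[of k] by (simp add: power2_eq_square)
    finally have "s k * (q * s (Suc k)) \<le> s k * s (Suc (Suc k))"
      by (simp add: mult_ac)
    then show ?case
      using Suc pos by simp
  qed (use s0 in \<open>simp add: q_def\<close>)
  have geo: "q ^ k * s 0 \<le> s k" for k
  proof (induction k)
    case (Suc k)
    have "q * (q ^ k * s 0) \<le> q * s k"
      using Suc q \<open>\<rho> > 0\<close> by (intro mult_left_mono) auto
    then show ?case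
      using step[of k] by (simp add: mult.assoc)
  qed simp
  have "(q / \<rho>) ^ k \<le> C / s 0" for k
    using order_trans[OF geo[of k] bound[of k]] s0 \<open>\<rho> > 0\<close> by (simp add: field_simps)
  moreover have "1 < q / \<rho>"
    using q \<open>\<rho> > 0\<close> by simp
  from real_arch_pow[OF this] obtain k where "C / s 0 < (q / \<rho>) ^ k"
    by blast
  ultimately show False
    using leD by blast
qed

text \<open>At a zero a of g both functions are divisible by z - a, and the simplicity of the zero
  leaves a denominator that is nonzero at a.\<close>

lemma holomorphic_quotient_simple_zeros:
  fixes f g :: "complex \<Rightarrow> complex"
  assumes "open S" and f: "f holomorphic_on S" and g: "g holomorphic_on S"
    and zero: "\<And>z. z \<in> S \<Longrightarrow> g z = 0 \<Longrightarrow> f z = 0 \<and> deriv g z \<noteq> 0"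
  obtains q where "q holomorphic_on S" "\<And>z. z \<in> S \<Longrightarrow> f z = q z * g z"
proof
  define q where "q z = (if g z = 0 then deriv f z / deriv g z else f z / g z)" for z
  show "f z = q z * g z" if "z \<in> S" for z
    using zero[OF that] by (auto simp: q_def)
  show "q holomorphic_on S"
    unfolding holomorphic_on_def
  proof
    fix a assume a: "a \<in> S"
    define quot where "quot h z = (if z = a then deriv h a else (h z - h a) / (z - a))" for h z
    have hol: "quot f holomorphic_on S" "quot g holomorphic_on S"
      using pole_lemma_open[OF f \<open>open S\<close>, of a] pole_lemma_open[OF g \<open>open S\<close>, of a]
      unfolding quot_def[abs_def] .
    \<comment> \<open>Near a, q is a quotient F / G with G nonzero at a: difference quotients if a
      is a zero of g, otherwise f and g themselves.\<close>
    obtain F G where FG: "F holomorphic_on S" "G holomorphic_on S" "G a \<noteq> 0"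
      "\<And>z. z \<in> S \<Longrightarrow> G z \<noteq> 0 \<Longrightarrow> F z / G z = q z"
    proof (cases "g a = 0")
      case True
      have "quot f z / quot g z = q z" if "z \<in> S" "quot g z \<noteq> 0" for z
        using that True zero[OF a True] by (auto simp: quot_def q_def split: if_splits)
      moreover have "quot g a \<noteq> 0"
        using zero[OF a True] by (simp add: quot_def)
      ultimately show ?thesis
        using that[OF hol] by blast
    next
      case False
      then show ?thesis
        using that[OF f g] by (simp add: q_def)
    qed
    have "continuous_on S G"
      using FG(2) by (rule holomorphic_on_imp_continuous_on)
    then have "open (S \<inter> G -` (- {0}))"
      using \<open>open S\<close> by (intro continuous_open_preimage) auto
    moreover have "a \<in> S \<inter> G -` (- {0})"
      using a FG(3) by simp
    ultimately obtain d where d: "d > 0" "ball a d \<subseteq> S \<inter> G -` (- {0})"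
      by (meson open_contains_ball)
    have "(\<lambda>z. F z / G z) field_differentiable at a within S"
      using FG(1-3) a by (intro field_differentiable_divide) (auto simp: holomorphic_on_def)
    then show "q field_differentiable at a within S"
    proof (rule field_differentiable_transform_within[OF d(1) a, rotated])
      fix z assume "z \<in> S" "dist z a < d"
      then show "F z / G z = q z"
        using FG(4)[of z] subsetD[OF d(2), of z] by (auto simp: dist_commute)
    qed
  qed
qed

section \<open>Zeros are simple, real and positive\<close>

context bessel_index
begin

lemma eval_eigen_1: "eval_fps (eigen w) 1 = eval_fps bess w"
  by (simp add: eval_eigen)

lemma eval_deriv_eigen: "eval_fps (fps_deriv (eigen w)) t = w * eval_fps (fps_deriv bess) (w * t)"
proof -
  have "((\<lambda>t. eval_fps bess (w * t)) has_real_derivative eval_fps (fps_deriv bess) (w * t) * (w * 1)) (at t)"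
    by (intro entire_has_derivative' DERIV_cmult DERIV_ident) simp
  moreover have "(eval_fps (eigen w) has_real_derivative eval_fps (fps_deriv (eigen w)) t) (at t)"
    by (intro entire_has_derivative) simp
  moreover have "eval_fps (eigen w) = (\<lambda>t. eval_fps bess (w * t))"
    by (simp add: eval_eigen fun_eq_iff)
  ultimately show ?thesis
    using DERIV_unique by (fastforce simp: mult.commute)
qed

lemma ip_eigen_pos: "0 < ip (eigen w) (eigen w)"
  by (rule ip_self_pos[of _ 0]) auto

text \<open>Green's identity for \<open>F = eigen w\<close> against \<open>t F'(t)\<close>, the derivative of the dilates of \<open>F\<close>.\<close>

lemma simple_zero:
  assumes "w > 0" "eval_fps bess w = 0"
  shows "eval_fps (fps_deriv (eigen w)) 1 \<noteq> 0" "eval_fps (fps_deriv bess) w \<noteq> (0 :: real)"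
proof -
  define F where "F = eigen w"
  define K where "K = fps_X * fps_deriv F"
  have [simp]: "entire F" "entire K"
    by (simp_all add: F_def K_def)
  \<comment> \<open>The commutator of \<open>opA\<close> with t d/dt is \<open>opA\<close> itself,
    by homogeneity.\<close>
  have "opA K = fps_X * fps_deriv (opA F) + opA F"
  proof (rule fps_ext)
    fix m show "fps_nth (opA K) m = fps_nth (fps_X * fps_deriv (opA F) + opA F) m"
      by (cases m) (simp_all add: K_def opA_nth algebra_simps)
  qed
  also have "\<dots> = fps_const w * K + fps_const w * F"
    by (simp add: F_def K_def opA_eigen mult_ac)
  finally have "ip (opA K) F = w * ip K F + w * ip F F"
    by (simp add: ip_def distrib_right wint_add mult.assoc wint_cmult)
  moreover have "ip K (opA F) = w * ip K F"
    by (simp add: F_def opA_eigen ip_cmult_right)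
  \<comment> \<open>F vanishes at 1 and K agrees there with F', so the boundary term is F'(1)^2 / 2;
    it cannot be 0, as w and the norm of F are positive.\<close>
  ultimately have "w * ip F F = (eval_fps (fps_deriv F) 1)\<^sup>2 / 2"
    using Green[of K F] assms(2) by (simp add: F_def eval_eigen_1 K_def power2_eq_square)
  then show *: "eval_fps (fps_deriv (eigen w)) 1 \<noteq> 0"
    using ip_eigen_pos[of w] assms(1) by (auto simp: F_def)
  then show "eval_fps (fps_deriv bess) w \<noteq> (0 :: real)"
    by (auto simp: eval_deriv_eigen)
qed

text \<open>For a \<le> 0 the alternating signs cancel and no term is negative, while the term of
  index 0 is 1. This excludes zeros that are not positive.\<close>

lemma bess_ge_1:
  assumes "a \<le> 0"
  shows "1 \<le> eval_fps bess (a :: real)"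
proof -
  have "(\<lambda>m. fps_nth bess m * a ^ m) sums eval_fps bess a"
    by (intro entire_sums) simp
  moreover have "0 \<le> fps_nth bess m * a ^ m" for m
  proof -
    have "(-1) ^ m * (- a) ^ m = a ^ m"
      by (simp flip: power_mult_distrib)
    then have "fps_nth bess m * a ^ m = ((-1) ^ m * \<tau> m) * (- a) ^ m"
      by (simp add: bess_def)
    also have "\<dots> \<ge> 0"
      using assms by (intro mult_nonneg_nonneg[OF less_imp_le[OF sgn_\<tau>]]) auto
    finally show ?thesis .
  qed
  ultimately have "(\<Sum>m\<in>{0}. fps_nth bess m * a ^ m) \<le> eval_fps bess a"
    using sum_le_suminf[OF sums_summable, of _ _ "{0}"] sums_unique by fastforce
  then show ?thesis
    by (simp add: bess_def)
qed

text \<open>Real and imaginary parts of \<open>t \<mapsto> bess (w t)\<close> form a pair on which the symmetric operator \<open>opA\<close>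
  acts as multiplication by \<open>w\<close>.\<close>

lemma zeros_real_positive:
  assumes "eval_fps bess (w :: complex) = 0"
  obtains x where "x > 0" "w = of_real x" "eval_fps bess x = 0"
proof -
  define P where "P = Abs_fps (\<lambda>m. \<tau> m * Re (w ^ m))"
  define Q where "Q = Abs_fps (\<lambda>m. \<tau> m * Im (w ^ m))"
  have ent: "entire F" if "\<And>m. \<bar>fps_nth F m\<bar> \<le> \<bar>\<tau> m\<bar> * norm w ^ m" for F :: "real fps"
    unfolding entire_iff_summable
  proof (intro allI impI)
    fix r :: real assume "r > 0"
    show "summable (\<lambda>n. norm (fps_nth F n) * r ^ n)"
    proof (rule summable_comparison_test_ev[OF _ summable_\<tau>[of "norm w * r"]])
      show "\<forall>\<^sub>F n in sequentially. norm (norm (fps_nth F n) * r ^ n) \<le> \<bar>\<tau> n\<bar> * (cmod w * r) ^ n"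
        using mult_right_mono[OF that, of "r ^ n" for n] \<open>r > 0\<close>
        by (intro always_eventually allI) (simp add: power_mult_distrib mult.assoc)
    qed
  qed
  have [simp]: "entire P" "entire Q"
    using abs_Re_le_cmod[of "w ^ m" for m] abs_Im_le_cmod[of "w ^ m" for m]
    by (auto intro!: ent mult_left_mono simp: P_def Q_def abs_mult norm_power)
  have sw: "(\<lambda>m. of_real (\<tau> m) * w ^ m) sums 0"
    using entire_sums[OF entire_bess, of w] assms by (simp add: bess_nth)
  have "(\<lambda>m. Re (of_real (\<tau> m) * w ^ m)) sums Re 0"
    using sw by (rule sums_Re)
  then have "(\<lambda>m. fps_nth P m * 1 ^ m) sums 0"
    by (simp add: P_def)
  then have P1: "eval_fps P 1 = 0"
    using entire_sums[of P 1] sums_unique2 by fastforce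
  have "(\<lambda>m. Im (of_real (\<tau> m) * w ^ m)) sums Im 0"
    using sw by (rule sums_Im)
  then have "(\<lambda>m. fps_nth Q m * 1 ^ m) sums 0"
    by (simp add: Q_def)
  then have Q1: "eval_fps Q 1 = 0"
    using entire_sums[of Q 1] sums_unique2 by fastforce
  have opA_\<tau>: "- (real (Suc m) * (real m + \<nu> + 1) * (\<tau> (Suc m) * c)) = \<tau> m * c" for m c
    by (simp add: \<tau>_Suc divide_simps del: of_nat_Suc)
  have AP: "opA P = fps_const (Re w) * P - fps_const (Im w) * Q"
    by (rule fps_ext) (simp only: opA_nth P_def Q_def fps_nth_Abs_fps opA_\<tau>, simp add: algebra_simps)
  have AQ: "opA Q = fps_const (Im w) * P + fps_const (Re w) * Q"
    by (rule fps_ext) (simp only: opA_nth P_def Q_def fps_nth_Abs_fps opA_\<tau>, simp add: algebra_simps)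
  have "ip (opA P) Q = ip P (opA Q)"
    by (intro opA_symmetric P1 Q1) auto
  \<comment> \<open>Expanding both sides by \<open>AP\<close> and \<open>AQ\<close>, the terms with
    Re w cancel.\<close>
  then have "Im w * (ip P P + ip Q Q) = 0"
    by (simp add: AP AQ ip_def left_diff_distrib distrib_left wint_add wint_diff wint_cmult
      mult.assoc mult.left_commute[of P "fps_const c" for c])
  moreover have "ip P P > 0"
  proof (rule ip_self_pos[of _ 0])
    show "eval_fps P 0 \<noteq> 0"
      by (simp add: eval_fps_at_0 P_def)
  qed auto
  moreover have "ip Q Q \<ge> 0"
    by (rule ip_self_nonneg) simp
  ultimately have w: "w = of_real (Re w)"
    by (simp add: complex_eq_iff)
  then have "of_real (eval_fps bess (Re w)) = (0 :: complex)"
    using assms eval_bess_of_real[of "Re w"] by simp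
  then have z: "eval_fps bess (Re w) = 0"
    by simp
  moreover have "Re w > 0"
    using bess_ge_1[of "Re w"] z by (cases "Re w > 0") auto
  ultimately show thesis
    using w that by blast
qed


section \<open>The inverse on the orthogonal complement of eigenfunctions\<close>

lemma abs_wint_le:
  assumes "entire S" "\<And>t. 0 \<le> t \<Longrightarrow> t \<le> 1 \<Longrightarrow> \<bar>eval_fps S t\<bar> \<le> B"
  shows "\<bar>wint S\<bar> \<le> B * wint 1"
proof -
  have le: "\<bar>x powr (2 * \<nu> + 1) * eval_fps S (x\<^sup>2)\<bar> \<le> B * (x powr (2 * \<nu> + 1) * eval_fps 1 (x\<^sup>2))"
    if "x \<in> space unit_measure" for x
  proof -
    have "\<bar>eval_fps S (x\<^sup>2)\<bar> \<le> B"
      using that by (intro assms(2)) (auto simp: power_le_one)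
    then have "x powr (2 * \<nu> + 1) * \<bar>eval_fps S (x\<^sup>2)\<bar> \<le> x powr (2 * \<nu> + 1) * B"
      by (intro mult_left_mono) auto
    then show ?thesis
      by (simp add: abs_mult mult.commute)
  qed
  have "\<bar>wint S\<bar> \<le> (\<integral>x. \<bar>x powr (2 * \<nu> + 1) * eval_fps S (x\<^sup>2)\<bar> \<partial>unit_measure)"
    unfolding wint_def by (rule integral_abs_bound)
  also have "\<dots> \<le> (\<integral>x. B * (x powr (2 * \<nu> + 1) * eval_fps 1 (x\<^sup>2)) \<partial>unit_measure)"
    using wint_integrable[OF assms(1)] wint_integrable[OF entire_1] le
    by (intro integral_mono) auto
  finally show ?thesis
    by (simp add: wint_def)
qed

lemma abs_ip_le:
  assumes "entire F" "entire G" "\<And>t. 0 \<le> t \<Longrightarrow> t \<le> 1 \<Longrightarrow> \<bar>eval_fps F t\<bar> \<le> B"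
    "\<And>t. 0 \<le> t \<Longrightarrow> t \<le> 1 \<Longrightarrow> \<bar>eval_fps G t\<bar> \<le> C"
  shows "\<bar>ip F G\<bar> \<le> B * C * wint 1"
  unfolding ip_def
proof (rule abs_wint_le)
  fix t :: real assume t: "0 \<le> t" "t \<le> 1"
  show "\<bar>eval_fps (F * G) t\<bar> \<le> B * C"
    using assms(3,4)[OF t] order_trans[OF abs_ge_zero assms(3)[OF t]] assms(1,2)
    by (simp add: abs_mult mult_mono)
qed (use assms in auto)

text \<open>The inverse of \<open>opA\<close> with the Dirichlet condition at 1.\<close>

definition invA :: "real fps \<Rightarrow> real fps" where
  "invA g = opT g - fps_const (eval_fps (opT g) 1)"

lemma entire_invA [simp]: "entire g \<Longrightarrow> entire (invA g)"
  by (simp add: invA_def)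

lemma opA_invA: "opA (invA g) = g"
  by (simp add: invA_def opA_diff opA_opT)

lemma eval_invA_1: "entire g \<Longrightarrow> eval_fps (invA g) 1 = 0"
  by (simp add: invA_def)

lemma invA_opA:
  assumes "entire F" "eval_fps F 1 = 0"
  shows "invA (opA F) = F"
proof -
  have "invA (opA F) = F - fps_const (fps_nth F 0) - fps_const (0 - fps_nth F 0)"
    unfolding invA_def opT_opA using assms by (simp only: eval_entire entire_const eval_fps_const)
  then show ?thesis
    by simp
qed

lemma entire_invA_pow [simp]: "entire h \<Longrightarrow> entire ((invA ^^ k) h)"
  by (induction k) auto

text \<open>As power series, \<open>\<beta> h\<close> is the product of \<open>\<alpha> h\<close> and \<open>bess\<close>, and \<open>\<beta> h\<close> and \<open>bess\<close> are entire, so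
  \<open>\<alpha> h\<close> is holomorphic as long as \<open>\<beta> h\<close> vanishes at the zeros of \<open>bess\<close>; the value of \<open>\<beta> h\<close> at such a zero
  \<open>w\<close> is a multiple of \<open>ip h (eigen w)\<close>.\<close>

definition \<alpha> :: "real fps \<Rightarrow> nat \<Rightarrow> real" where
  "\<alpha> h k = eval_fps (opT ((invA ^^ k) h)) 1"

text \<open>\<open>invA\<close> is \<open>opT\<close> minus a constant, so iteration leaves a sum of
  constants carried along by the later applications of \<open>opT\<close>.\<close>

lemma invA_pow_expand:
  "(invA ^^ k) h = (opT ^^ k) h - (\<Sum>i<k. fps_const (\<alpha> h i) * (opT ^^ (k - Suc i)) 1)"
proof (induction k)
  case (Suc k)
  have "(invA ^^ Suc k) h = opT ((invA ^^ k) h) - fps_const (\<alpha> h k)"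
    by (simp add: invA_def \<alpha>_def)
  also have "opT ((invA ^^ k) h) =
      (opT ^^ Suc k) h - (\<Sum>i<k. fps_const (\<alpha> h i) * opT ((opT ^^ (k - Suc i)) 1))"
    by (simp add: Suc opT_diff opT_sum opT_mult_const)
  also have "(\<Sum>i<k. fps_const (\<alpha> h i) * opT ((opT ^^ (k - Suc i)) 1)) =
      (\<Sum>i<k. fps_const (\<alpha> h i) * (opT ^^ (Suc k - Suc i)) 1)"
  proof (rule sum.cong)
    fix i assume "i \<in> {..<k}"
    then have "Suc k - Suc i = Suc (k - Suc i)"
      by auto
    then show "fps_const (\<alpha> h i) * opT ((opT ^^ (k - Suc i)) 1) =
        fps_const (\<alpha> h i) * (opT ^^ (Suc k - Suc i)) 1"
      by simp
  qed simp
  finally show ?case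
    by simp
qed simp

lemma eval_opT_pow_1: "eval_fps ((opT ^^ k) 1) t = \<tau> k * t ^ k"
  unfolding opT_pow_1 by (simp add: entire_def)

lemma eval_invA_pow:
  assumes "entire h"
  shows "eval_fps ((invA ^^ k) h) t =
    eval_fps ((opT ^^ k) h) t - (\<Sum>i<k. \<alpha> h i * (\<tau> (k - Suc i) * t ^ (k - Suc i)))"
  unfolding invA_pow_expand using assms
  by (simp add: eval_entire_sum entire_sum eval_opT_pow_1)

text \<open>Taylor coefficients in w of the value at t = 1 of the solution of (\<open>opA\<close> -
  w) F = h with F(0) = 0, written as a Neumann series in \<open>opT\<close>.\<close>

definition \<beta> :: "real fps \<Rightarrow> nat \<Rightarrow> real" where
  "\<beta> h k = eval_fps ((opT ^^ Suc k) h) 1"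

text \<open>This is the Dirichlet condition at 1 for the power k + 1 of \<open>invA\<close>, written
  out by \<open>eval_invA_pow\<close>; the right side is a Cauchy product with the coefficients of
  \<open>bess\<close>.\<close>

lemma \<beta>_convolution:
  assumes "entire h"
  shows "\<beta> h k = (\<Sum>i=0..k. \<alpha> h i * \<tau> (k - i))"
proof -
  have "eval_fps ((invA ^^ Suc k) h) 1 = 0"
    using assms eval_invA_1 by simp
  then show ?thesis
    unfolding eval_invA_pow[OF assms] \<beta>_def
    by (simp add: atLeast0AtMost lessThan_Suc_atMost)
qed

lemma abs_\<beta>_le: "entire h \<Longrightarrow> \<bar>\<beta> h k\<bar> \<le> \<bar>\<tau> (Suc k)\<bar> * coeff_norm h"
  unfolding \<beta>_def by (rule abs_eval_opT_pow_le) auto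

lemma summable_\<tau>_Suc: "r > 0 \<Longrightarrow> summable (\<lambda>k. \<bar>\<tau> (Suc k)\<bar> * r ^ k)"
  using summable_mult[OF summable_\<tau>[of r, THEN summable_Suc_iff[THEN iffD2]], of "1 / r"] by simp

lemma entire_\<beta>:
  assumes "entire h"
  shows "entire (Abs_fps (\<lambda>k. of_real (\<beta> h k)) :: complex fps)"
  unfolding entire_iff_summable
proof (intro allI impI)
  fix r :: real assume "r > 0"
  have "summable (\<lambda>k. coeff_norm h * (\<bar>\<tau> (Suc k)\<bar> * r ^ k))"
    by (intro summable_mult summable_\<tau>_Suc \<open>r > 0\<close>)
  then show "summable (\<lambda>k. norm (fps_nth (Abs_fps (\<lambda>k. of_real (\<beta> h k)) :: complex fps) k) * r ^ k)"
  proof (rule summable_comparison_test_ev[rotated])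
    show "\<forall>\<^sub>F k in sequentially.
        norm (norm (fps_nth (Abs_fps (\<lambda>k. of_real (\<beta> h k)) :: complex fps) k) * r ^ k)
        \<le> coeff_norm h * (\<bar>\<tau> (Suc k)\<bar> * r ^ k)"
      using mult_right_mono[OF abs_\<beta>_le[OF assms], of "r ^ k" k for k] \<open>r > 0\<close>
      by (intro always_eventually allI) (simp add: mult_ac)
  qed
qed

text \<open>Green's identity against \<open>eigen w\<close>, which vanishes at 1, turns each term
  into a difference of consecutive multiples of w^k \<open>ip ((opT ^^ k) h) (eigen w)\<close>. The
  series telescopes, and the factor |\<tau> k| sends the tail to 0.\<close>

lemma \<beta>_sums_at_zero:
  assumes "entire h" "w > 0" "eval_fps bess w = 0"
  shows "(\<lambda>k. \<beta> h k * w ^ k) sums (2 * ip h (eigen w) / eval_fps (fps_deriv (eigen w)) 1)"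
proof -
  let ?D = "eval_fps (fps_deriv (eigen w)) 1"
  have D: "?D \<noteq> 0"
    using simple_zero(1)[OF assms(2,3)] .
  let ?e = "\<lambda>k. 2 * (w ^ k * ip ((opT ^^ k) h) (eigen w)) / ?D"
  have step: "?e k - ?e (Suc k) = \<beta> h k * w ^ k" for k
  proof -
    let ?g = "(opT ^^ Suc k) h"
    have "ip (opA ?g) (eigen w) - ip ?g (opA (eigen w)) = \<beta> h k * ?D / 2"
      using Green[of ?g "eigen w"] assms by (simp add: eval_eigen_1 \<beta>_def)
    then have "ip ((opT ^^ k) h) (eigen w) - w * ip ?g (eigen w) = \<beta> h k * ?D / 2"
      using assms(1) by (simp add: opA_opT opA_eigen ip_cmult_right)
    then have \<beta>_eq: "\<beta> h k = 2 * (ip ((opT ^^ k) h) (eigen w) - w * ip ?g (eigen w)) / ?D"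
      using D by (simp add: field_simps)
    show ?thesis
      unfolding \<beta>_eq by (simp add: right_diff_distrib diff_divide_distrib mult_ac del: funpow.simps)
  qed
  have "(\<lambda>k. \<bar>\<tau> k\<bar> * w ^ k * (coeff_norm h * coeff_norm (eigen w) * wint 1)) \<longlonglongrightarrow> 0"
    using summable_LIMSEQ_zero[OF summable_\<tau>[of w]] by (intro tendsto_mult_left_zero)
  then have "(\<lambda>k. w ^ k * ip ((opT ^^ k) h) (eigen w)) \<longlonglongrightarrow> 0"
  proof (rule Lim_null_comparison[rotated])
    have "\<bar>ip ((opT ^^ k) h) (eigen w)\<bar> \<le> (\<bar>\<tau> k\<bar> * coeff_norm h) * coeff_norm (eigen w) * wint 1" for k
      using assms(1) abs_eval_opT_pow_le[of h] abs_eval_le_coeff_norm[of "eigen w"]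
      by (intro abs_ip_le) auto
    from mult_left_mono[OF this, of "w ^ k" for k]
    show "\<forall>\<^sub>F k in sequentially. norm (w ^ k * ip ((opT ^^ k) h) (eigen w)) \<le>
        \<bar>\<tau> k\<bar> * w ^ k * (coeff_norm h * coeff_norm (eigen w) * wint 1)"
      using \<open>w > 0\<close> by (intro always_eventually allI) (simp add: abs_mult mult_ac)
  qed
  then have "?e \<longlonglongrightarrow> 2 * 0 / ?D"
    using D by (intro tendsto_intros) auto
  then have "?e \<longlonglongrightarrow> 0"
    by simp
  from telescope_sums'[OF this] show ?thesis
    unfolding step by simp
qed

text \<open>Orthogonality makes the series of \<open>\<beta> h\<close> vanish at every zero of
  \<open>bess\<close> in the ball of radius R. These zeros are simple, so the quotient is
  holomorphic there and its Taylor coefficients \<open>\<alpha> h\<close> are controlled for r <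
  R.\<close>

lemma \<alpha>_bounded:
  assumes h: "entire h"
    and orth: "\<And>w. 0 < w \<Longrightarrow> w < R \<Longrightarrow> eval_fps bess w = 0 \<Longrightarrow> ip h (eigen w) = 0"
    and r: "0 < r" "r < R"
  obtains C where "\<And>k. \<bar>\<alpha> h k\<bar> * r ^ k \<le> C" "C \<ge> 0"
proof -
  define A where "A = (Abs_fps (\<lambda>k. of_real (\<alpha> h k)) :: complex fps)"
  define B where "B = (Abs_fps (\<lambda>k. of_real (\<beta> h k)) :: complex fps)"
  have [simp]: "entire B"
    unfolding B_def by (rule entire_\<beta>[OF h])
  have BA: "B = A * bess"
    by (rule fps_ext) (simp add: A_def B_def fps_mult_nth \<beta>_convolution[OF h] bess_nth)
  have hol: "eval_fps F holomorphic_on X" if "entire F" for F X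
    using that by (intro holomorphic_on_eval_fps) (auto simp: entire_def)
  have zero: "eval_fps B z = 0 \<and> deriv (eval_fps bess) z \<noteq> 0"
    if "z \<in> ball 0 R" "eval_fps bess z = 0" for z
  proof -
    from that(2) obtain x where x: "x > 0" "z = of_real x" "eval_fps bess x = 0"
      by (rule zeros_real_positive)
    have "(\<lambda>k. of_real (\<beta> h k * x ^ k)) sums (of_real 0 :: complex)"
      using \<beta>_sums_at_zero[OF h x(1,3)] orth[OF x(1) _ x(3)] that(1) x(1,2)
      by (intro sums_of_real) auto
    moreover have "(\<lambda>k. fps_nth B k * z ^ k) sums eval_fps B z"
      by (rule entire_sums) simp
    ultimately have "eval_fps B z = 0"
      using sums_unique2 by (fastforce simp: B_def x(2))
    moreover have "deriv (eval_fps bess) z = eval_fps (fps_deriv bess) z"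
      by (intro DERIV_imp_deriv entire_has_derivative) simp
    moreover have "eval_fps (fps_deriv bess) z = (of_real (eval_fps (fps_deriv bess) x) :: complex)"
    proof -
      have "(\<lambda>n. of_real (fps_nth (fps_deriv bess) n * x ^ n)) sums
          (of_real (eval_fps (fps_deriv bess) x) :: complex)"
        by (intro sums_of_real entire_sums) auto
      moreover have "(\<lambda>n. fps_nth (fps_deriv bess) n * z ^ n) sums eval_fps (fps_deriv bess) z"
        by (intro entire_sums) auto
      ultimately show ?thesis
        by (simp add: bess_nth x(2) sums_unique2)
    qed
    ultimately show ?thesis
      using simple_zero(2)[OF x(1,3)] by simp
  qed
  obtain q where q: "q holomorphic_on ball 0 R"
    "\<And>z. z \<in> ball 0 R \<Longrightarrow> eval_fps B z = q z * eval_fps bess z"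
    using holomorphic_quotient_simple_zeros[of "ball 0 R" "eval_fps B" "eval_fps bess"] zero hol
    by (metis \<open>entire B\<close> entire_bess open_ball)
  have qe: "q has_fps_expansion fps_expansion q 0"
    using r by (intro has_fps_expansion_fps_expansion[OF open_ball _ q(1)]) auto
  have "(\<lambda>z. q z * eval_fps bess z) has_fps_expansion fps_expansion q 0 * bess"
    by (intro has_fps_expansion_mult qe eval_fps_has_fps_expansion)
       (use entire_bess[where 'a = complex] in \<open>simp add: entire_def\<close>)
  moreover have "\<forall>\<^sub>F z in nhds 0. q z * eval_fps bess z = eval_fps B z"
    using eventually_nhds_in_open[of "ball 0 R" 0] r by (auto elim!: eventually_mono simp: q(2))
  ultimately have "eval_fps B has_fps_expansion fps_expansion q 0 * bess"
    using has_fps_expansion_cong[of "\<lambda>z. q z * eval_fps bess z" "eval_fps B", OF _ refl] by simp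
  moreover have "eval_fps B has_fps_expansion B"
    using \<open>entire B\<close> by (intro eval_fps_has_fps_expansion) (simp add: entire_def)
  ultimately have "B = fps_expansion q 0 * bess"
    using fps_expansion_unique_complex by blast
  moreover have "bess \<noteq> (0 :: complex fps)"
    by (metis \<tau>_0 bess_nth fps_zero_nth of_real_1 zero_neq_one)
  \<comment> \<open>Formal power series form an integral domain, so the nonzero factor
    \<open>bess\<close> cancels.\<close>
  ultimately have "fps_expansion q 0 = A"
    using BA by simp
  then have "fps_conv_radius A \<ge> ereal R"
    using conv_radius_fps_expansion[of q 0 "ereal R"] q(1) by simp
  moreover have "ereal (norm (of_real r :: complex)) < ereal R"
    using r by simp
  ultimately have "ereal (norm (of_real r :: complex)) < fps_conv_radius A"
    using less_le_trans by blast
  then have "summable (\<lambda>k. norm (fps_nth A k * of_real r ^ k))"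
    by (rule norm_summable_fps)
  then have s: "summable (\<lambda>k. \<bar>\<alpha> h k\<bar> * r ^ k)"
    using r by (simp add: A_def norm_mult norm_power)
  have "\<bar>\<alpha> h k\<bar> * r ^ k \<le> (\<Sum>k. \<bar>\<alpha> h k\<bar> * r ^ k)" for k
    using sum_le_suminf[OF s, of "{k}"] r by simp
  moreover have "(\<Sum>k. \<bar>\<alpha> h k\<bar> * r ^ k) \<ge> 0"
    using s r by (intro suminf_nonneg) auto
  ultimately show thesis
    using that by blast
qed

text \<open>Times r^k, the convolution in \<open>eval_invA_pow\<close> pairs the bounded sequence
  \<alpha> h i r^i with the summable sequence \<tau> m r^m.\<close>

lemma invA_pow_bounded:
  assumes h: "entire h"
    and orth: "\<And>w. 0 < w \<Longrightarrow> w < R \<Longrightarrow> eval_fps bess w = 0 \<Longrightarrow> ip h (eigen w) = 0"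
    and r: "0 < r" "r < R"
  obtains C where "\<And>k t. 0 \<le> t \<Longrightarrow> t \<le> 1 \<Longrightarrow> \<bar>eval_fps ((invA ^^ k) h) t\<bar> \<le> C * (1 / r) ^ k"
proof -
  obtain D where D: "\<And>k. \<bar>\<alpha> h k\<bar> * r ^ k \<le> D" "D \<ge> 0"
    using \<alpha>_bounded[OF assms] by blast
  define M where "M = (\<Sum>m. \<bar>\<tau> m\<bar> * r ^ m)"
  have M: "(\<Sum>m\<in>I. \<bar>\<tau> m\<bar> * r ^ m) \<le> M" if "finite I" for I
    unfolding M_def using r that by (intro sum_le_suminf summable_\<tau>) auto
  show thesis
  proof (rule that)
    fix k and t :: real assume t: "0 \<le> t" "t \<le> 1"
    have "\<bar>eval_fps ((invA ^^ k) h) t\<bar> \<le> \<bar>eval_fps ((opT ^^ k) h) t\<bar>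
        + (\<Sum>i<k. \<bar>\<alpha> h i * (\<tau> (k - Suc i) * t ^ (k - Suc i))\<bar>)"
      unfolding eval_invA_pow[OF h] by (rule order_trans[OF abs_triangle_ineq4 add_left_mono[OF sum_abs]])
    also have "\<dots> \<le> \<bar>\<tau> k\<bar> * coeff_norm h + (\<Sum>i<k. \<bar>\<alpha> h i\<bar> * \<bar>\<tau> (k - Suc i)\<bar>)"
    proof (intro add_mono abs_eval_opT_pow_le sum_mono h t)
      fix i
      have "\<bar>\<tau> (k - Suc i)\<bar> * t ^ (k - Suc i) \<le> \<bar>\<tau> (k - Suc i)\<bar> * 1"
        using t by (intro mult_left_mono power_le_one) auto
      then show "\<bar>\<alpha> h i * (\<tau> (k - Suc i) * t ^ (k - Suc i))\<bar> \<le> \<bar>\<alpha> h i\<bar> * \<bar>\<tau> (k - Suc i)\<bar>"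
        using t by (simp add: abs_mult mult_left_mono)
    qed
    finally have "\<bar>eval_fps ((invA ^^ k) h) t\<bar> * r ^ k \<le>
        (\<bar>\<tau> k\<bar> * coeff_norm h + (\<Sum>i<k. \<bar>\<alpha> h i\<bar> * \<bar>\<tau> (k - Suc i)\<bar>)) * r ^ k"
      using r by (intro mult_right_mono) auto
    also have "\<dots> = \<bar>\<tau> k\<bar> * r ^ k * coeff_norm h
        + (\<Sum>i<k. r * ((\<bar>\<alpha> h i\<bar> * r ^ i) * (\<bar>\<tau> (k - Suc i)\<bar> * r ^ (k - Suc i))))"
    proof -
      \<comment> \<open>One factor r is left over, since i + (k - Suc i) = k - 1.\<close>
      have "r ^ k = r * (r ^ i * r ^ (k - Suc i))" if "i < k" for i
        using that by (simp flip: power_add power_Suc)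
      then have *: "\<bar>\<alpha> h i\<bar> * \<bar>\<tau> (k - Suc i)\<bar> * r ^ k =
          r * ((\<bar>\<alpha> h i\<bar> * r ^ i) * (\<bar>\<tau> (k - Suc i)\<bar> * r ^ (k - Suc i)))" if "i < k" for i
        using that by simp
      then show ?thesis
        unfolding distrib_right sum_distrib_right by (intro arg_cong2[of _ _ _ _ "(+)"] sum.cong) (auto simp: *)
    qed
    also have "\<dots> \<le> M * coeff_norm h + (\<Sum>i<k. r * (D * (\<bar>\<tau> (k - Suc i)\<bar> * r ^ (k - Suc i))))"
      using M[of "{k}"] coeff_norm_nonneg[OF h] r D
      by (intro add_mono mult_right_mono sum_mono mult_left_mono) auto
    also have "(\<Sum>i<k. r * (D * (\<bar>\<tau> (k - Suc i)\<bar> * r ^ (k - Suc i)))) =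
        r * D * (\<Sum>m<k. \<bar>\<tau> m\<bar> * r ^ m)"
      using sum.nat_diff_reindex[of "\<lambda>m. \<bar>\<tau> m\<bar> * r ^ m" k]
      by (simp add: sum_distrib_left[symmetric] mult.assoc)
    also have "\<dots> \<le> r * D * M"
      using r D(2) by (intro mult_left_mono M) auto
    finally have "\<bar>eval_fps ((invA ^^ k) h) t\<bar> * r ^ k \<le> M * coeff_norm h + r * D * M"
      by simp
    then show "\<bar>eval_fps ((invA ^^ k) h) t\<bar> \<le> (M * coeff_norm h + r * D * M) * (1 / r) ^ k"
      using r by (simp add: power_one_over field_simps)
  qed
qed

text \<open>The squared norms of the iterates are log-convex, by symmetry and Cauchy-Schwarz, and
  decay like r^(-2k); hence the first ratio is at most 1/r^2. A further use of Cauchy-Schwarz bounds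
  the quadratic form.\<close>

lemma invA_gap:
  assumes h [simp]: "entire h"
    and orth: "\<And>w. 0 < w \<Longrightarrow> w < R \<Longrightarrow> eval_fps bess w = 0 \<Longrightarrow> ip h (eigen w) = 0"
    and r: "0 < r" "r < R"
  shows "ip h (invA h) \<le> ip h h / r" "ip (invA h) (invA h) \<le> ip h h / r\<^sup>2"
proof -
  define U where "U k = (invA ^^ k) h" for k
  define s where "s k = ip (U k) (U k)" for k
  have [simp]: "entire (U k)" for k
    by (simp add: U_def)
  have U_Suc: "U (Suc k) = invA (U k)" for k
    by (simp add: U_def)
  have opA_U: "opA (U (Suc k)) = U k" for k
    by (simp add: U_Suc opA_invA)
  obtain C where C: "\<And>k t. 0 \<le> t \<Longrightarrow> t \<le> 1 \<Longrightarrow> \<bar>eval_fps (U k) t\<bar> \<le> C * (1 / r) ^ k"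
    using invA_pow_bounded[OF assms] unfolding U_def by blast
  have nn: "0 \<le> s k" for k
    unfolding s_def by (rule ip_self_nonneg) simp
  have conv: "(s (Suc k))\<^sup>2 \<le> s k * s (Suc (Suc k))" for k
  proof -
    have "s (Suc k) = ip (opA (U (Suc (Suc k)))) (U (Suc k))"
      by (simp add: s_def opA_U)
    also have "\<dots> = ip (U (Suc (Suc k))) (opA (U (Suc k)))"
      by (rule opA_symmetric) (simp_all add: U_Suc eval_invA_1)
    also have "\<dots> = ip (U k) (U (Suc (Suc k)))"
      by (simp add: opA_U ip_commute)
    finally show ?thesis
      using ip_Cauchy_Schwarz[of "U k" "U (Suc (Suc k))"] by (simp add: s_def)
  qed
  have bound: "s k \<le> C * C * wint 1 * ((1 / r)\<^sup>2) ^ k" for k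
  proof -
    have "\<bar>s k\<bar> \<le> (C * (1 / r) ^ k) * (C * (1 / r) ^ k) * wint 1"
      unfolding s_def by (intro abs_ip_le C) auto
    also have "\<dots> = C * C * wint 1 * ((1 / r)\<^sup>2) ^ k"
      unfolding power2_eq_square power_mult_distrib by (simp only: mult_ac)
    finally show ?thesis
      by linarith
  qed
  have s1: "s 1 \<le> (1 / r)\<^sup>2 * s 0"
    using r by (intro log_convex_ratio_le[OF nn conv bound]) auto
  have "(ip h (invA h))\<^sup>2 \<le> s 0 * s 1"
    using ip_Cauchy_Schwarz[of h "invA h"] by (simp add: s_def U_def)
  also have "\<dots> \<le> s 0 * ((1 / r)\<^sup>2 * s 0)"
    using s1 nn by (intro mult_left_mono) auto
  also have "\<dots> = (s 0 / r)\<^sup>2"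
    by (simp add: power2_eq_square)
  finally have "ip h (invA h) \<le> s 0 / r"
    by (rule power2_le_imp_le) (use nn[of 0] r in auto)
  then show "ip h (invA h) \<le> ip h h / r"
    by (simp add: s_def U_def)
  show "ip (invA h) (invA h) \<le> ip h h / r\<^sup>2"
    using s1 by (simp add: s_def U_def power_divide)
qed

end

section \<open>Eigenfunction expansions in the energy norm\<close>

text \<open>A nonzero power series has no zero near 0 other than possibly 0 itself.\<close>

lemma entire_eq_0:
  fixes F :: "real fps"
  assumes "entire F" "\<And>t. t \<in> {0..1} \<Longrightarrow> eval_fps F t = 0"
  shows "F = 0"
proof (rule ccontr)
  assume "F \<noteq> 0"
  then obtain m where m: "fps_nth F m \<noteq> 0"
    by (metis fps_nonzero_nth)
  have "fps_nth F 0 = 0"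
    using assms(2)[of 0] by (simp add: eval_fps_at_0)
  then have "m > 0"
    using m by (cases m) auto
  have "(\<lambda>n. fps_nth F n * (x - 0) ^ n) sums eval_fps F x" for x
    using entire_sums[OF assms(1), of x] by simp
  from powser_0_nonzero[OF zero_less_one this _ m \<open>m > 0\<close>] assms(2)[of 0]
  obtain s where s: "0 < s" "\<And>z. z \<in> cball 0 s - {0} \<Longrightarrow> eval_fps F z \<noteq> 0"
    by auto
  show False
    using s(1) s(2)[of "min s 1"] assms(2)[of "min s 1"] by (cases "s \<le> 1") (auto simp: min_def)
qed

section \<open>The eigenvalues: discrete, infinitely many, with a least one\<close>

context bessel_index
begin

definition zeros :: "real set" where
  "zeros = {w. 0 < w \<and> eval_fps bess w = 0}"

text \<open>A nonconstant entire function has finitely many zeros in a closed disc; a constant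
  \<open>bess\<close> would be 1 and have none.\<close>

lemma finite_zeros_le: "finite {w \<in> zeros. w \<le> R}"
proof (cases "eval_fps bess constant_on (UNIV :: complex set)")
  case True
  then have "eval_fps bess z = (1 :: complex)" for z
    using eval_fps_at_0[of "bess :: complex fps"] bess_nth[of 0]
    by (auto simp: constant_on_def)
  then have "zeros = {}"
    using eval_bess_of_real by (force simp: zeros_def)
  then show ?thesis
    by simp
next
  case False
  have "eval_fps bess holomorphic_on (UNIV :: complex set)"
    using entire_bess[where 'a = complex] by (intro holomorphic_on_eval_fps) (auto simp: entire_def)
  then have "finite {z \<in> cball 0 R. eval_fps bess z = (0 :: complex)}"
    using False by (intro holomorphic_compact_finite_zeros[of _ UNIV]) auto
  then show ?thesis
  proof (rule inj_on_finite[rotated 2])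
    show "inj_on complex_of_real {w \<in> zeros. w \<le> R}"
      by (simp add: inj_on_def)
    show "complex_of_real ` {w \<in> zeros. w \<le> R} \<subseteq> {z \<in> cball 0 R. eval_fps bess z = 0}"
      by (auto simp: zeros_def eval_bess_of_real)
  qed
qed

lemma eigen_orth:
  assumes "v \<in> zeros" "w \<in> zeros" "v \<noteq> w"
  shows "ip (eigen v) (eigen w) = 0"
proof -
  have "ip (opA (eigen v)) (eigen w) = ip (eigen v) (opA (eigen w))"
    using assms by (intro opA_symmetric) (auto simp: zeros_def eval_eigen_1)
  then show ?thesis
    using assms(3) by (simp add: opA_eigen ip_cmult_left ip_cmult_right)
qed

definition fcoef :: "real fps \<Rightarrow> real \<Rightarrow> real" where
  "fcoef f w = ip f (eigen w) / ip (eigen w) (eigen w)"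

definition partial :: "real fps \<Rightarrow> real set \<Rightarrow> real fps" where
  "partial f Z = (\<Sum>w\<in>Z. fps_const (fcoef f w) * eigen w)"

lemma entire_partial [simp]: "entire (partial f Z)"
  unfolding partial_def by (intro entire_sum) simp

lemma ip_partial:
  assumes "finite Z" "Z \<subseteq> zeros" "w \<in> Z"
  shows "ip (partial f Z) (eigen w) = ip f (eigen w)"
proof -
  have "ip (partial f Z) (eigen w) = (\<Sum>v\<in>Z. fcoef f v * ip (eigen v) (eigen w))"
    unfolding partial_def by (subst ip_sum_left) (auto simp: ip_cmult_left)
  also have "\<dots> = (\<Sum>v\<in>{w}. fcoef f v * ip (eigen v) (eigen w))"
    using assms by (intro sum.mono_neutral_right) (auto intro!: eigen_orth)
  finally show ?thesis
    using ip_eigen_pos[of w] by (simp add: fcoef_def)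
qed

lemma ip_resid:
  assumes "finite Z" "Z \<subseteq> zeros" "w \<in> Z" "entire f"
  shows "ip (f - partial f Z) (eigen w) = 0"
  using assms by (simp add: ip_diff_left ip_partial)

text \<open>Pythagoras: the residual is orthogonal to the partial sum.\<close>

lemma resid_norm_le:
  assumes "finite Z" "Z \<subseteq> zeros" and [simp]: "entire f"
  shows "ip (f - partial f Z) (f - partial f Z) \<le> ip f f"
proof -
  let ?r = "f - partial f Z" and ?s = "partial f Z"
  have "ip ?s ?r = (\<Sum>v\<in>Z. fcoef f v * ip (eigen v) ?r)"
    by (subst (1) partial_def, subst ip_sum_left) (auto simp: ip_cmult_left)
  also have "\<dots> = 0"
    using assms by (intro sum.neutral) (auto simp: ip_resid ip_commute[of "eigen _"])
  finally have "ip ?s ?r = 0" .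
  then have "ip f f = ip ?r ?r + ip ?s ?s"
    by (simp add: ip_diff_left ip_diff_right ip_commute[of f "partial f Z"])
  then show ?thesis
    using ip_self_nonneg[of ?s] by simp
qed

text \<open>With finitely many eigenvalues, the residual h of the constant 1 would be orthogonal to
  all eigenfunctions. The gap bound, then valid for every r, forces \<open>invA h\<close> and so h
  to vanish, although h has the value 1 at t = 1.\<close>

lemma infinite_zeros: "infinite zeros"
proof
  assume fin: "finite zeros"
  define h where "h = 1 - partial 1 zeros"
  have [simp]: "entire h"
    by (simp add: h_def)
  have "ip h (eigen w) = 0" if "w \<in> zeros" for w
    unfolding h_def using fin that by (intro ip_resid) auto
  then have gap: "ip (invA h) (invA h) \<le> ip h h / r\<^sup>2" if "r > 0" for r
    using that by (intro invA_gap(2)[of h "r + 1"]) (auto simp: zeros_def)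
  have "(\<lambda>n. ip h h / (real (Suc n))\<^sup>2) \<longlonglongrightarrow> 0"
    by (intro tendsto_divide_0[OF tendsto_const] filterlim_at_top_imp_at_infinity
      filterlim_pow_at_top filterlim_compose[OF filterlim_real_sequentially filterlim_Suc]) auto
  then have "ip (invA h) (invA h) \<le> 0"
    by (rule tendsto_lowerbound) (use gap in auto)
  then have "ip (invA h) (invA h) = 0"
    using ip_self_nonneg[of "invA h"] by simp
  then have "invA h = 0"
    by (intro entire_eq_0 ip_self_eq_0_imp) auto
  then have "h = 0"
    using opA_invA[of h] opA_const[of 0] by simp
  then have "eval_fps h 1 = 0"
    by simp
  moreover have "eval_fps (partial 1 zeros) 1 = 0"
    unfolding partial_def by (subst eval_entire_sum) (auto simp: eval_eigen_1 zeros_def)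
  ultimately show False
    by (simp add: h_def)
qed

text \<open>\<open>Min\<close> asks for a finite set; cutting at an arbitrarily chosen zero provides
  one without changing the minimum.\<close>

definition first_zero :: real where
  "first_zero = Min {w \<in> zeros. w \<le> (SOME z. z \<in> zeros)}"

lemma first_zero: "first_zero \<in> zeros" "w \<in> zeros \<Longrightarrow> first_zero \<le> w"
proof -
  define z where "z = (SOME z. z \<in> zeros)"
  have "z \<in> zeros"
    unfolding z_def by (rule someI_ex) (use infinite_imp_nonempty[OF infinite_zeros] in auto)
  then have ne: "{w \<in> zeros. w \<le> z} \<noteq> {}"
    by auto
  have m: "first_zero \<in> {w \<in> zeros. w \<le> z}"
    unfolding first_zero_def z_def[symmetric] by (rule Min_in[OF finite_zeros_le ne])
  then show "first_zero \<in> zeros"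
    by simp
  show "first_zero \<le> w" if "w \<in> zeros"
  proof (cases "w \<le> z")
    case True
    then show ?thesis
      unfolding first_zero_def z_def[symmetric] using that by (intro Min_le finite_zeros_le) auto
  qed (use m in auto)
qed

lemma first_zero_pos: "0 < first_zero"
  using first_zero(1) by (simp add: zeros_def)

definition ground :: "real fps" where
  "ground = eigen first_zero"

lemma entire_ground [simp]: "entire ground"
  by (simp add: ground_def)

lemma ground_1: "eval_fps ground 1 = 0"
  using first_zero(1) by (simp add: ground_def eval_eigen_1 zeros_def)

lemma opA_ground: "opA ground = fps_const first_zero * ground"
  by (simp add: ground_def opA_eigen)

lemma deriv_ground_1: "eval_fps (fps_deriv ground) 1 \<noteq> 0"
  using simple_zero(1)[of first_zero] first_zero(1) by (simp add: ground_def zeros_def)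

text \<open>Otherwise the intermediate value theorem, starting from the value 1 at 0, gives a zero s
  with 0 < s < 1, and \<open>first_zero * s\<close> would be a smaller zero of
  \<open>bess\<close>.\<close>

lemma ground_pos:
  assumes "0 \<le> t" "t < 1"
  shows "0 < eval_fps ground t"
proof (rule ccontr)
  assume "\<not> 0 < eval_fps ground t"
  then obtain s where s: "0 \<le> s" "s \<le> t" "eval_fps ground s = 0"
    using IVT2'[of "eval_fps ground" t 0 0] assms entire_continuous_on[of ground "{0..t}"]
    by (auto simp: ground_def)
  have "s \<noteq> 0"
    using s(3) by (auto simp: ground_def)
  then have "first_zero * s \<in> zeros"
    using s first_zero_pos by (auto simp: zeros_def ground_def eval_eigen)
  from first_zero(2)[OF this] show False
    using s assms first_zero_pos by simp
qed

text \<open>In the variable \<open>x\<close>, the operator \<open>f \<mapsto> f' - (\<phi>'/\<phi>) f\<close> that annihilates the first eigenfunction.\<close>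

definition darboux :: "real fps \<Rightarrow> real \<Rightarrow> real" where
  "darboux F x = 2 * x * (eval_fps (fps_deriv F) (x\<^sup>2)
     - eval_fps F (x\<^sup>2) * eval_fps (fps_deriv ground) (x\<^sup>2) / eval_fps ground (x\<^sup>2))"

lemma eval_opA:
  assumes "entire F"
  shows "eval_fps (opA F) t =
    - (t * eval_fps (fps_deriv (fps_deriv F)) t + (\<nu> + 1) * eval_fps (fps_deriv F) t)"
proof -
  have "entire (fps_X * fps_deriv (fps_deriv F) + fps_const (\<nu> + 1) * fps_deriv F)"
    using assms by simp
  from eval_entire_uminus[OF this] show ?thesis
    unfolding opA_def using assms by simp
qed

lemma darboux_diff: "entire F \<Longrightarrow> entire G \<Longrightarrow> darboux (F - G) x = darboux F x - darboux G x"
  by (simp add: darboux_def algebra_simps diff_divide_distrib)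

lemma darboux_cmult: "entire F \<Longrightarrow> darboux (fps_const c * F) x = c * darboux F x"
  by (simp add: darboux_def algebra_simps)

lemma darboux_0: "darboux 0 x = 0"
  by (simp add: darboux_def)

lemma darboux_add: "entire F \<Longrightarrow> entire G \<Longrightarrow> darboux (F + G) x = darboux F x + darboux G x"
  by (simp add: darboux_def algebra_simps add_divide_distrib)

lemma darboux_sum:
  "(\<And>i. i \<in> I \<Longrightarrow> entire (F i)) \<Longrightarrow> darboux (\<Sum>i\<in>I. F i) x = (\<Sum>i\<in>I. darboux (F i) x)"
  by (induction I rule: infinite_finite_induct) (auto simp: darboux_0 darboux_add entire_sum)

text \<open>This is why the three systems start at the index 2.\<close>

lemma darboux_ground:
  assumes "0 < x" "x < 1"
  shows "darboux ground x = 0"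
  using ground_pos[of "x\<^sup>2"] assms by (simp add: darboux_def power_less_one_iff abs_square_less_1)

text \<open>The part of the product rule that differentiates \<open>ground\<close> cancels.
  Polynomials p thus yield the weighted even polynomials to which Weierstrass' theorem
  applies.\<close>

lemma darboux_ground_mult:
  assumes "0 < x" "x < 1" "entire p"
  shows "darboux (ground * p) x = 2 * x * eval_fps ground (x\<^sup>2) * eval_fps (fps_deriv p) (x\<^sup>2)"
  using ground_pos[of "x\<^sup>2"] assms
  by (simp add: darboux_def power_less_one_iff abs_square_less_1 field_simps)

text \<open>The equation for P is diagonal in the coefficients, with nonzero factors k + \<nu> + 1;
  hence every weighted integrand is exact.\<close>

lemma entire_primitive:
  assumes "entire S"
  obtains P where "entire P" "S = fps_const (\<nu> + 1) * P + fps_X * fps_deriv P"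
proof
  define P where "P = Abs_fps (\<lambda>k. fps_nth S k / (real k + \<nu> + 1))"
  show "S = fps_const (\<nu> + 1) * P + fps_X * fps_deriv P"
  proof (rule fps_ext)
    fix k
    have "fps_nth (fps_const (\<nu> + 1) * P + fps_X * fps_deriv P) k = (real k + \<nu> + 1) * fps_nth P k"
      by (cases k) (simp_all add: algebra_simps)
    then show "fps_nth S k = fps_nth (fps_const (\<nu> + 1) * P + fps_X * fps_deriv P) k"
      by (simp add: P_def)
  qed
  show "entire P"
    unfolding entire_iff_summable
  proof (intro allI impI)
    fix r :: real assume r: "r > 0"
    have "summable (\<lambda>k. 1 / (\<nu> + 1) * (norm (fps_nth S k) * r ^ k))"
      using assms r by (intro summable_mult) (auto simp: entire_iff_summable)
    then show "summable (\<lambda>k. norm (fps_nth P k) * r ^ k)"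
    proof (rule summable_comparison_test_ev[rotated], intro always_eventually allI)
      fix k
      have "\<bar>fps_nth S k\<bar> / (real k + \<nu> + 1) \<le> \<bar>fps_nth S k\<bar> / (\<nu> + 1)"
        using nu by (intro divide_left_mono) auto
      from mult_right_mono[OF this, of "r ^ k"]
      show "norm (norm (fps_nth P k) * r ^ k) \<le> 1 / (\<nu> + 1) * (norm (fps_nth S k) * r ^ k)"
        using r by (simp add: P_def)
    qed
  qed
qed

text \<open>Picone's identity for the first eigenfunction.\<close>

lemma darboux_energy:
  assumes [simp]: "entire F" and F1: "eval_fps F 1 = 0"
  shows "integrable unit_measure (\<lambda>x. x powr (2 * \<nu> + 1) * (darboux F x)\<^sup>2)"
    and "(\<integral>x. x powr (2 * \<nu> + 1) * (darboux F x)\<^sup>2 \<partial>unit_measure)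
      = 4 * (ip F (opA F) - first_zero * ip F F)"
proof -
  define S where "S = F * opA F - fps_const first_zero * (F * F)"
  have [simp]: "entire S"
    by (simp add: S_def)
  obtain P where [simp]: "entire P" and SP: "S = fps_const (\<nu> + 1) * P + fps_X * fps_deriv P"
    using entire_primitive[of S] by auto
  define L where "L x = eval_fps (fps_deriv F) (x\<^sup>2)
     - eval_fps F (x\<^sup>2) * eval_fps (fps_deriv ground) (x\<^sup>2) / eval_fps ground (x\<^sup>2)" for x
  define E where "E x = eval_fps F (x\<^sup>2) * L x" for x
  \<comment> \<open>An antiderivative of f: the first summand accounts for S, the second is the
    boundary expression F (F' - F ground' / ground) of Picone's identity.\<close>
  define G where "G x = x powr (2 * \<nu> + 2) * eval_fps P (x\<^sup>2) + x powr (2 * \<nu> + 2) * E x" for x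
  define f where "f x = 2 * (x powr (2 * \<nu> + 1) * (x * L x)\<^sup>2)" for x
  have pos: "0 < eval_fps ground (x\<^sup>2)" if "0 \<le> x" "x < 1" for x
    using that by (intro ground_pos) (auto simp: power_less_one_iff)
  have ev: "((\<lambda>x. eval_fps H (x\<^sup>2)) has_real_derivative eval_fps (fps_deriv H) (x\<^sup>2) * (2 * x)) (at x)"
    if "entire H" for H x
    using that by (rule entire_has_derivative_square)
  have L_deriv: "(L has_real_derivative
      2 * x * (eval_fps (fps_deriv (fps_deriv F)) (x\<^sup>2)
       - eval_fps (fps_deriv F) (x\<^sup>2) * eval_fps (fps_deriv ground) (x\<^sup>2) / eval_fps ground (x\<^sup>2)
       - eval_fps F (x\<^sup>2) * eval_fps (fps_deriv (fps_deriv ground)) (x\<^sup>2) / eval_fps ground (x\<^sup>2)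
       + eval_fps F (x\<^sup>2) * (eval_fps (fps_deriv ground) (x\<^sup>2))\<^sup>2 / (eval_fps ground (x\<^sup>2))\<^sup>2)) (at x)"
    if "0 \<le> x" "x < 1" for x
    unfolding L_def
    by (rule DERIV_cong[OF DERIV_diff[OF ev DERIV_divide[OF DERIV_mult[OF ev ev] ev]]])
      (use pos[OF that] in \<open>auto simp: field_simps power2_eq_square\<close>)
  have L_cont: "isCont L x" if "0 \<le> x" "x < 1" for x
    using L_deriv[OF that] by (rule DERIV_isCont)
  have P_deriv: "((\<lambda>x. x powr (2 * \<nu> + 2) * eval_fps P (x\<^sup>2)) has_real_derivative
      2 * (x powr (2 * \<nu> + 1) * eval_fps S (x\<^sup>2))) (at x)" if "0 < x" for x
    unfolding SP by (rule wint_antiderivative(1)[OF _ that]) simp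
  have deriv: "(G has_real_derivative f x) (at x)" if x: "0 < x" "x < 1" for x
  proof -
    define a a1 a2 b b1 b2 where ab: "a = eval_fps F (x\<^sup>2)" "a1 = eval_fps (fps_deriv F) (x\<^sup>2)"
      "a2 = eval_fps (fps_deriv (fps_deriv F)) (x\<^sup>2)" "b = eval_fps ground (x\<^sup>2)"
      "b1 = eval_fps (fps_deriv ground) (x\<^sup>2)" "b2 = eval_fps (fps_deriv (fps_deriv ground)) (x\<^sup>2)"
    have b: "b > 0"
      using pos[of x] x by (simp add: ab)
    have Sx: "eval_fps S (x\<^sup>2) = - a * (x\<^sup>2 * a2 + (\<nu> + 1) * a1) - first_zero * a\<^sup>2"
      by (simp add: S_def eval_opA ab power2_eq_square algebra_simps)
    have "eval_fps (opA ground) (x\<^sup>2) = first_zero * b"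
      by (simp add: opA_ground ab)
    then have gx: "first_zero * b = - (x\<^sup>2 * b2 + (\<nu> + 1) * b1)"
      by (simp add: eval_opA ab)
    have p: "x powr (2 * \<nu> + 2 - 1) = x powr (2 * \<nu> + 1)" "x powr (2 * \<nu> + 2) = x * x powr (2 * \<nu> + 1)"
    proof -
      have e: "2 * \<nu> + 2 = 1 + (2 * \<nu> + 1)"
        by simp
      show "x powr (2 * \<nu> + 2) = x * x powr (2 * \<nu> + 1)"
        unfolding e powr_add using x by simp
      show "x powr (2 * \<nu> + 2 - 1) = x powr (2 * \<nu> + 1)"
        by (rule arg_cong[where f = "\<lambda>y. x powr y"]) simp
    qed
    define W where "W = x powr (2 * \<nu> + 1)"
    have Lx: "L x = a1 - a * b1 / b"
      by (simp add: L_def ab)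
    have "(G has_real_derivative 2 * (W * eval_fps S (x\<^sup>2)) +
        ((2 * \<nu> + 2) * W * (a * L x) + (a1 * (2 * x) * L x
          + 2 * x * (a2 - a1 * b1 / b - a * b2 / b + a * b1\<^sup>2 / b\<^sup>2) * a) * (x * W))) (at x)"
      unfolding G_def E_def W_def ab
      using DERIV_add[OF P_deriv[OF x(1)] DERIV_mult[OF has_real_derivative_powr[OF x(1), of "2 * \<nu> + 2"]
        DERIV_mult[OF ev[OF assms(1)] L_deriv[of x]]]] x
      unfolding p by simp
    \<comment> \<open>The last bracket is the eigenvalue equation of \<open>ground\<close> and
      vanishes by \<open>gx\<close>.\<close>
    also have "2 * (W * eval_fps S (x\<^sup>2)) +
        ((2 * \<nu> + 2) * W * (a * L x) + (a1 * (2 * x) * L x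
          + 2 * x * (a2 - a1 * b1 / b - a * b2 / b + a * b1\<^sup>2 / b\<^sup>2) * a) * (x * W))
      = 2 * W * (x * L x)\<^sup>2 - 2 * W * a\<^sup>2 / b * (first_zero * b + (x\<^sup>2 * b2 + (\<nu> + 1) * b1))"
      unfolding Sx Lx using b by (simp add: field_simps power2_eq_square)
    also have "\<dots> = f x"
      unfolding gx by (simp add: f_def W_def)
    finally show ?thesis .
  qed
  have cont: "isCont f x" if "0 < x" "x < 1" for x
  proof -
    have "isCont (\<lambda>x. x powr (2 * \<nu> + 1)) x"
      by (rule DERIV_isCont[OF has_real_derivative_powr[OF that(1)]])
    then show ?thesis
      unfolding f_def[abs_def] using L_cont[of x] that
      by (intro continuous_mult continuous_power continuous_const continuous_ident) auto
  qed
  have G0: "(G \<longlongrightarrow> 0) (at_right 0)"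
  proof -
    have "((\<lambda>x. x powr (2 * \<nu> + 2)) \<longlongrightarrow> 0) (at_right (0 :: real))"
      using nu by (auto intro!: tendsto_eq_intros eventually_at_rightI[of 0 1])
    moreover have "isCont E 0"
      unfolding E_def[abs_def] using L_cont[of 0] DERIV_isCont[OF ev[OF assms(1), of 0]]
      by (intro continuous_mult) auto
    then have "(E \<longlongrightarrow> E 0) (at_right 0)"
      by (simp add: isCont_def filterlim_at_split)
    ultimately have "((\<lambda>x. x powr (2 * \<nu> + 2) * E x) \<longlongrightarrow> 0 * E 0) (at_right 0)"
      by (rule tendsto_mult)
    from tendsto_add[OF wint_antiderivative(2)[OF \<open>entire P\<close>] this] show ?thesis
      by (simp add: G_def[abs_def])
  qed
  \<comment> \<open>F and \<open>ground\<close> both vanish at 1. Dividing each by x - 1 shows that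
    F / ground has a finite limit, as the derivative of \<open>ground\<close> at 1 is nonzero; the
    remaining factor F then sends E to 0.\<close>
  have quot: "((\<lambda>x. eval_fps H (x\<^sup>2) / (x - 1)) \<longlongrightarrow> eval_fps (fps_deriv H) 1 * 2) (at_left 1)"
    if "entire H" "eval_fps H 1 = 0" for H :: "real fps"
    using entire_has_derivative_square[OF that(1), of 1 "{..<1}"] that(2)
    by (simp add: has_field_derivative_iff)
  have evl: "((\<lambda>x. eval_fps H (x\<^sup>2)) \<longlongrightarrow> eval_fps H 1) (at_left 1)" if "entire H" for H :: "real fps"
    using DERIV_isCont[OF ev[OF that, of 1]] by (simp add: isCont_def filterlim_at_split)
  have G1: "(G \<longlongrightarrow> eval_fps P 1) (at_left 1)"
  proof -
    have "((\<lambda>x. (eval_fps F (x\<^sup>2) / (x - 1)) / (eval_fps ground (x\<^sup>2) / (x - 1))) \<longlongrightarrow>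
        (eval_fps (fps_deriv F) 1 * 2) / (eval_fps (fps_deriv ground) 1 * 2)) (at_left 1)"
      using deriv_ground_1 by (intro tendsto_divide quot F1 ground_1) auto
    moreover have "eventually (\<lambda>x. (eval_fps F (x\<^sup>2) / (x - 1)) / (eval_fps ground (x\<^sup>2) / (x - 1))
        = eval_fps F (x\<^sup>2) / eval_fps ground (x\<^sup>2)) (at_left (1::real))"
      by (rule eventually_at_leftI[of 0]) auto
    ultimately have "((\<lambda>x. eval_fps F (x\<^sup>2) / eval_fps ground (x\<^sup>2)) \<longlongrightarrow>
        (eval_fps (fps_deriv F) 1 * 2) / (eval_fps (fps_deriv ground) 1 * 2)) (at_left 1)"
      by (rule Lim_transform_eventually)
    then have "((\<lambda>x. eval_fps F (x\<^sup>2) * (eval_fps (fps_deriv F) (x\<^sup>2)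
        - eval_fps F (x\<^sup>2) / eval_fps ground (x\<^sup>2) * eval_fps (fps_deriv ground) (x\<^sup>2))) \<longlongrightarrow>
      eval_fps F 1 * (eval_fps (fps_deriv F) 1 - (eval_fps (fps_deriv F) 1 * 2) /
        (eval_fps (fps_deriv ground) 1 * 2) * eval_fps (fps_deriv ground) 1)) (at_left 1)"
      by (intro tendsto_mult tendsto_diff evl) auto
    then have "(E \<longlongrightarrow> 0) (at_left 1)"
      by (simp add: F1 E_def[abs_def] L_def)
    moreover have "((\<lambda>x. x powr (2 * \<nu> + 2)) \<longlongrightarrow> 1) (at_left (1 :: real))"
      by (auto intro!: tendsto_eq_intros)
    ultimately have "((\<lambda>x. x powr (2 * \<nu> + 2) * E x) \<longlongrightarrow> 1 * 0) (at_left 1)"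
      by (intro tendsto_mult)
    from tendsto_add[OF wint_antiderivative(3)[OF \<open>entire P\<close>] this] show ?thesis
      by (simp add: G_def[abs_def])
  qed
  have eq: "x powr (2 * \<nu> + 1) * (darboux F x)\<^sup>2 = 2 * f x" for x
    by (simp add: darboux_def f_def L_def power2_eq_square)
  have nonneg: "0 \<le> f x" for x
    by (simp add: f_def)
  have int: "integrable unit_measure f" "(\<integral>x. f x \<partial>unit_measure) = eval_fps P 1 - 0"
    using unit_FTC_nonneg[OF deriv cont nonneg G0 G1] by auto
  show "integrable unit_measure (\<lambda>x. x powr (2 * \<nu> + 1) * (darboux F x)\<^sup>2)"
    unfolding eq using int(1) by simp
  have "wint S = eval_fps P 1 / 2"
    unfolding SP by (rule wint_exact) simp
  moreover have "wint S = ip F (opA F) - first_zero * ip F F"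
    unfolding S_def ip_def by (simp add: wint_diff wint_cmult)
  ultimately show "(\<integral>x. x powr (2 * \<nu> + 1) * (darboux F x)\<^sup>2 \<partial>unit_measure)
      = 4 * (ip F (opA F) - first_zero * ip F F)"
    unfolding eq using int(2) by simp
qed

text \<open>Taking residuals commutes with \<open>opA\<close>, so \<open>opA F\<close> is the
  residual of g = \<open>opA f\<close>: orthogonal to the low eigenfunctions and of norm at most
  that of g. The gap bound then controls the energy of F.\<close>

lemma darboux_resid_small:
  assumes [simp]: "entire f" and f1: "eval_fps f 1 = 0" and "\<epsilon> > 0"
  obtains Z where "finite Z" "Z \<subseteq> zeros"
    "(\<integral>x. x powr (2 * \<nu> + 1) * (darboux (f - partial f Z) x)\<^sup>2 \<partial>unit_measure) < \<epsilon>"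
proof -
  define g where "g = opA f"
  \<comment> \<open>Chosen so that 4 \<open>ip g g\<close> / r < \<epsilon>; the summand 1 keeps r
    positive.\<close>
  define r where "r = 4 * ip g g / \<epsilon> + 1"
  have [simp]: "entire g"
    by (simp add: g_def)
  have r: "r > 0"
    using ip_self_nonneg[of g] \<open>\<epsilon> > 0\<close> by (simp add: r_def add_nonneg_pos)
  \<comment> \<open>The cut at r + 1 leaves room for r < R in \<open>invA_gap\<close>.\<close>
  define Z where "Z = {w \<in> zeros. w \<le> r + 1}"
  have Z: "finite Z" "Z \<subseteq> zeros"
    using finite_zeros_le by (auto simp: Z_def)
  define F where "F = f - partial f Z"
  have [simp]: "entire F"
    by (simp add: F_def)
  have "eval_fps (partial f Z) 1 = 0"
    unfolding partial_def using Z
    by (subst eval_entire_sum) (auto intro!: sum.neutral simp: eval_eigen_1 zeros_def)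
  then have F1: "eval_fps F 1 = 0"
    by (simp add: F_def f1)
  have "fcoef g w = fcoef f w * w" if "w \<in> Z" for w
  proof -
    have "ip g (eigen w) = ip f (opA (eigen w))"
      unfolding g_def using that f1 by (intro opA_symmetric) (auto simp: Z_def zeros_def eval_eigen_1)
    then show ?thesis
      by (simp add: fcoef_def opA_eigen ip_cmult_right)
  qed
  then have opAF: "opA F = g - partial g Z"
    unfolding F_def opA_diff partial_def opA_sum opA_mult_const opA_eigen
    by (simp add: g_def[symmetric] mult.assoc[symmetric])
  have "ip (opA F) (eigen w) = 0" if "0 < w" "w < r + 1" "eval_fps bess w = 0" for w
    unfolding opAF using Z that by (intro ip_resid) (auto simp: Z_def zeros_def)
  then have "ip (opA F) (invA (opA F)) \<le> ip (opA F) (opA F) / r"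
    using r by (intro invA_gap(1)[of _ "r + 1"]) auto
  also have "invA (opA F) = F"
    by (rule invA_opA) (auto simp: F1)
  also have "ip (opA F) (opA F) / r \<le> ip g g / r"
    unfolding opAF using r Z by (intro divide_right_mono resid_norm_le) auto
  finally have "4 * (ip F (opA F) - first_zero * ip F F) \<le> 4 * (ip g g / r)"
    using mult_nonneg_nonneg[OF less_imp_le[OF first_zero_pos] ip_self_nonneg[of F]]
    by (simp add: ip_commute[of "opA F" F])
  also have "\<dots> < \<epsilon>"
    using r \<open>\<epsilon> > 0\<close> by (simp add: r_def field_simps)
  finally show thesis
    using that[OF Z] darboux_energy(2)[OF \<open>entire F\<close> F1] by (simp add: F_def)
qed

end

section \<open>Density of weighted even polynomials\<close>

text \<open>(a + b)^2 \<le> 2 a^2 + 2 b^2 stands in for the triangle inequality: two squared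
  distances below \<epsilon>/4 combine to less than \<epsilon>.\<close>

lemma L2_square_integrable_add:
  fixes f g :: "'a \<Rightarrow> real"
  assumes [measurable]: "f \<in> borel_measurable M" "g \<in> borel_measurable M"
    and f: "integrable M (\<lambda>x. (f x)\<^sup>2)" and g: "integrable M (\<lambda>x. (g x)\<^sup>2)"
  shows "integrable M (\<lambda>x. (f x + g x)\<^sup>2)"
    and "(\<integral>x. (f x + g x)\<^sup>2 \<partial>M) \<le> 2 * (\<integral>x. (f x)\<^sup>2 \<partial>M) + 2 * (\<integral>x. (g x)\<^sup>2 \<partial>M)"
proof -
  have le: "(f x + g x)\<^sup>2 \<le> 2 * (f x)\<^sup>2 + 2 * (g x)\<^sup>2" for x
    using zero_le_power2[of "f x - g x"] by (simp add: power2_eq_square algebra_simps)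
  have int: "integrable M (\<lambda>x. 2 * (f x)\<^sup>2 + 2 * (g x)\<^sup>2)"
    using f g by simp
  then show *: "integrable M (\<lambda>x. (f x + g x)\<^sup>2)"
    by (rule Bochner_Integration.integrable_bound) (use le in auto)
  have "(\<integral>x. (f x + g x)\<^sup>2 \<partial>M) \<le> (\<integral>x. 2 * (f x)\<^sup>2 + 2 * (g x)\<^sup>2 \<partial>M)"
    by (rule integral_mono[OF * int le])
  then show "(\<integral>x. (f x + g x)\<^sup>2 \<partial>M) \<le> 2 * (\<integral>x. (f x)\<^sup>2 \<partial>M) + 2 * (\<integral>x. (g x)\<^sup>2 \<partial>M)"
    using f g by simp
qed

lemma L2_close_trans:
  fixes f g h :: "'a \<Rightarrow> real"
  assumes [measurable]: "f \<in> borel_measurable M" "g \<in> borel_measurable M" "h \<in> borel_measurable M"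
    and "integrable M (\<lambda>x. (f x - g x)\<^sup>2)" "(\<integral>x. (f x - g x)\<^sup>2 \<partial>M) < \<epsilon> / 4"
    and "integrable M (\<lambda>x. (g x - h x)\<^sup>2)" "(\<integral>x. (g x - h x)\<^sup>2 \<partial>M) < \<epsilon> / 4"
  shows "integrable M (\<lambda>x. (f x - h x)\<^sup>2)" "(\<integral>x. (f x - h x)\<^sup>2 \<partial>M) < \<epsilon>"
  using L2_square_integrable_add[of "\<lambda>x. f x - g x" M "\<lambda>x. g x - h x"] assms by auto

text \<open>A measurable function is an a.e. limit of continuous ones; clipped at B and cut off near
  the endpoints, these converge by dominated convergence. Support away from 0 and 1 permits a later
  division by a weight that may degenerate there.\<close>

lemma bounded_approx_continuous:
  fixes g :: "real \<Rightarrow> real"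
  assumes g [measurable]: "g \<in> borel_measurable borel" and B: "\<And>x. \<bar>g x\<bar> \<le> B" and "\<epsilon> > 0"
  obtains \<psi> :: "real \<Rightarrow> real" and a b where "continuous_on UNIV \<psi>" "0 < a" "a \<le> b" "b < 1"
    "\<And>x. x \<notin> {a..b} \<Longrightarrow> \<psi> x = 0"
    "integrable unit_measure (\<lambda>x. (g x - \<psi> x)\<^sup>2)" "(\<integral>x. (g x - \<psi> x)\<^sup>2 \<partial>unit_measure) < \<epsilon>"
proof -
  have "g \<in> borel_measurable lebesgue"
    using g by (simp add: measurable_completion)
  then have "g measurable_on UNIV"
    by (rule lebesgue_measurable_imp_measurable_on) (use sets.top[of lebesgue] in simp)
  then obtain N G where N: "negligible N" and G: "\<And>n. continuous_on UNIV (G n)"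
    "\<And>x. x \<notin> N \<Longrightarrow> (\<lambda>n. G n x) \<longlonglongrightarrow> g x"
    unfolding measurable_on_def by auto
  have B0: "B \<ge> 0"
    using B[of 0] by simp
  \<comment> \<open>Equal to 0 within 1/(n+3) of an endpoint and to 1 at distance at least 2/(n+3);
    the shift by 3 keeps the supporting interval nonempty.\<close>
  define cut where "cut n x = max 0 (min 1 (real (n + 3) * min x (1 - x) - 1))" for n :: nat and x :: real
  define \<psi> where "\<psi> n x = cut n x * max (- B) (min B (G n x))" for n x
  have cont: "continuous_on UNIV (\<psi> n)" for n
    unfolding \<psi>_def cut_def by (intro continuous_intros G)
  have meas [measurable]: "\<psi> n \<in> borel_measurable borel" for n
    using cont by (rule borel_measurable_continuous_onI)
  have zero: "\<psi> n x = 0" if "x \<notin> {1 / real (n + 3)..1 - 1 / real (n + 3)}" for n x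
  proof -
    have "min x (1 - x) \<le> 1 / real (n + 3)"
      using that by auto
    then have "real (n + 3) * min x (1 - x) \<le> 1"
      by (simp add: field_simps)
    then show ?thesis
      by (simp add: \<psi>_def cut_def)
  qed
  have bound: "(g x - \<psi> n x)\<^sup>2 \<le> (2 * B)\<^sup>2" for n x
  proof -
    have "\<bar>\<psi> n x\<bar> \<le> 1 * B"
      unfolding \<psi>_def abs_mult using B0 by (intro mult_mono) (auto simp: cut_def)
    then have "\<bar>g x - \<psi> n x\<bar> \<le> \<bar>2 * B\<bar>"
      using B[of x] by linarith
    then show ?thesis
      by (simp only: abs_le_square_iff)
  qed
  have lim: "(\<lambda>n. (g x - \<psi> n x)\<^sup>2) \<longlonglongrightarrow> 0" if x: "x \<in> {0<..<1}" "x \<notin> N" for x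
  proof -
    have "(\<lambda>n. max (- B) (min B (G n x))) \<longlonglongrightarrow> max (- B) (min B (g x))"
      by (intro tendsto_intros G(2) x)
    moreover have "max (- B) (min B (g x)) = g x"
      using B[of x] by auto
    moreover have "eventually (\<lambda>n. cut n x = 1) sequentially"
    proof -
      define m where "m = min x (1 - x)"
      have m: "m > 0"
        using x by (auto simp: m_def)
      obtain n0 where n0: "2 / m < real n0"
        using reals_Archimedean2 by blast
      have "cut n x = 1" if "n \<ge> n0" for n
      proof -
        have "2 / m \<le> real (n + 3)"
          using n0 that by linarith
        then have "2 \<le> real (n + 3) * m"
          using m by (simp add: divide_le_eq)
        then show ?thesis
          by (simp add: cut_def m_def)
      qed
      then show ?thesis
        by (auto simp: eventually_sequentially)
    qed
    then have "(\<lambda>n. cut n x) \<longlonglongrightarrow> 1"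
      by (rule tendsto_eventually)
    ultimately have "(\<lambda>n. \<psi> n x) \<longlonglongrightarrow> 1 * g x"
      unfolding \<psi>_def by (intro tendsto_mult) auto
    from tendsto_power[OF tendsto_diff[OF tendsto_const[of "g x"] this], of 2] show ?thesis
      by simp
  qed
  interpret finite_measure unit_measure
    by (rule finite_unit_measure)
  have um [measurable]: "g \<in> borel_measurable unit_measure" "\<psi> n \<in> borel_measurable unit_measure" for n
    by (auto intro: measurable_unit_measureI)
  have "AE x in lborel. x \<notin> N"
    using N by (metis AE_completion_iff AE_not_in negligible_iff_null_sets)
  then have AE: "AE x in unit_measure. x \<notin> N"
    unfolding unit_measure_def by (subst AE_restrict_space_iff) auto
  have "(\<lambda>n. \<integral>x. (g x - \<psi> n x)\<^sup>2 \<partial>unit_measure) \<longlonglongrightarrow> (\<integral>x. 0 \<partial>unit_measure)"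
  proof (rule integral_dominated_convergence[where w = "\<lambda>_. (2 * B)\<^sup>2"])
    show "AE x in unit_measure. (\<lambda>n. (g x - \<psi> n x)\<^sup>2) \<longlonglongrightarrow> 0"
      using AE AE_space by eventually_elim (rule lim, simp_all)
    show "AE x in unit_measure. norm ((g x - \<psi> n x)\<^sup>2) \<le> (2 * B)\<^sup>2" for n
      using bound by auto
  qed auto
  then have "eventually (\<lambda>n. (\<integral>x. (g x - \<psi> n x)\<^sup>2 \<partial>unit_measure) < \<epsilon>) sequentially"
    using \<open>\<epsilon> > 0\<close> by (intro order_tendstoD(2)) auto
  then obtain n where n: "(\<integral>x. (g x - \<psi> n x)\<^sup>2 \<partial>unit_measure) < \<epsilon>"
    by (auto simp: eventually_sequentially)
  have int: "integrable unit_measure (\<lambda>x. (g x - \<psi> n x)\<^sup>2)"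
    by (rule integrable_const_bound[of _ "(2 * B)\<^sup>2"]) (use bound in auto)
  show thesis
    by (rule that[where a = "1 / real (n + 3)" and b = "1 - 1 / real (n + 3)", OF cont _ _ _ zero int n])
      (auto simp: field_simps)
qed

text \<open>The error is dominated by g^2 and is eventually 0 at each point.\<close>

lemma truncation_approx:
  fixes g :: "'a \<Rightarrow> real"
  assumes [measurable]: "g \<in> borel_measurable M" and int: "integrable M (\<lambda>x. (g x)\<^sup>2)" and "\<epsilon> > 0"
  obtains B where "B > 0" "integrable M (\<lambda>x. (g x - max (- B) (min B (g x)))\<^sup>2)"
    "(\<integral>x. (g x - max (- B) (min B (g x)))\<^sup>2 \<partial>M) < \<epsilon>"
proof -
  define T where "T n x = max (- real (Suc n)) (min (real (Suc n)) (g x))" for n x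
  have [measurable]: "T n \<in> borel_measurable M" for n
    unfolding T_def by measurable
  have bound: "(g x - T n x)\<^sup>2 \<le> (g x)\<^sup>2" for n x
  proof -
    have "\<bar>g x - T n x\<bar> \<le> \<bar>g x\<bar>"
      by (auto simp: T_def max_def min_def)
    then show ?thesis
      by (simp only: abs_le_square_iff)
  qed
  have lim: "(\<lambda>n. (g x - T n x)\<^sup>2) \<longlonglongrightarrow> 0" for x
  proof (rule tendsto_eventually)
    obtain n0 where "\<bar>g x\<bar> < real n0"
      using reals_Archimedean2 by blast
    then have "(g x - T n x)\<^sup>2 = 0" if "n \<ge> n0" for n
      using that by (auto simp: T_def max_def min_def)
    then show "eventually (\<lambda>n. (g x - T n x)\<^sup>2 = 0) sequentially"
      by (auto simp: eventually_sequentially)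
  qed
  have "(\<lambda>n. \<integral>x. (g x - T n x)\<^sup>2 \<partial>M) \<longlonglongrightarrow> (\<integral>x. 0 \<partial>M)"
    by (rule integral_dominated_convergence[OF _ _ int]) (use bound lim in auto)
  then have "eventually (\<lambda>n. (\<integral>x. (g x - T n x)\<^sup>2 \<partial>M) < \<epsilon>) sequentially"
    using \<open>\<epsilon> > 0\<close> by (intro order_tendstoD(2)) auto
  then obtain n where n: "(\<integral>x. (g x - T n x)\<^sup>2 \<partial>M) < \<epsilon>"
    by (auto simp: eventually_sequentially)
  moreover have "integrable M (\<lambda>x. (g x - T n x)\<^sup>2)"
    by (rule Bochner_Integration.integrable_bound[OF int]) (use bound in auto)
  ultimately show thesis
    using that[of "real (Suc n)"] by (simp add: T_def)
qed

text \<open>Since \<open>x \<mapsto> x\<^sup>2\<close> is a homeomorphism of the unit interval, Weierstrass' theorem applies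
  to \<open>\<psi> / \<sigma>\<close> as a function of the square of the variable.\<close>

lemma weighted_even_polynomials_dense:
  fixes g \<sigma> :: "real \<Rightarrow> real"
  assumes g: "g \<in> L2_space unit_measure" and "\<epsilon> > 0"
    and \<sigma>: "continuous_on {0<..<1} \<sigma>" "\<And>x. 0 < x \<Longrightarrow> x < 1 \<Longrightarrow> 0 < \<sigma> x"
    and \<sigma>_int: "integrable unit_measure (\<lambda>x. (\<sigma> x)\<^sup>2)"
  obtains q where "integrable unit_measure (\<lambda>x. (g x - \<sigma> x * poly q (x\<^sup>2))\<^sup>2)"
    "(\<integral>x. (g x - \<sigma> x * poly q (x\<^sup>2))\<^sup>2 \<partial>unit_measure) < \<epsilon>"
proof -
  have gm [measurable]: "g \<in> borel_measurable unit_measure"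
    and gi: "integrable unit_measure (\<lambda>x. (g x)\<^sup>2)"
    using g by (auto simp: L2_space_def)
  have \<sigma>m [measurable]: "\<sigma> \<in> borel_measurable unit_measure"
    using borel_measurable_continuous_on_restrict[OF \<sigma>(1)] sets_unit_measure
    by (simp cong: measurable_cong_sets)
  obtain B where B: "B > 0" "integrable unit_measure (\<lambda>x. (g x - max (- B) (min B (g x)))\<^sup>2)"
    "(\<integral>x. (g x - max (- B) (min B (g x)))\<^sup>2 \<partial>unit_measure) < \<epsilon> / 4"
    using truncation_approx[OF gm gi, of "\<epsilon> / 4"] \<open>\<epsilon> > 0\<close> by auto
  define g' where "g' x = indicator {0<..<1} x * max (- B) (min B (g x))" for x :: real
  have "(\<lambda>x. max (- B) (min B (g x))) \<in> borel_measurable (restrict_space borel {0<..<1})"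
    using gm sets_unit_measure by (simp cong: measurable_cong_sets)
  then have g'm [measurable]: "g' \<in> borel_measurable borel"
    by (subst (asm) borel_measurable_restrict_space_iff) (auto simp: g'_def[abs_def] mult.commute)
  have g': "g' x = max (- B) (min B (g x))" if "x \<in> space unit_measure" for x
    using that by (simp add: g'_def)
  have step1: "integrable unit_measure (\<lambda>x. (g x - g' x)\<^sup>2)" "(\<integral>x. (g x - g' x)\<^sup>2 \<partial>unit_measure) < \<epsilon> / 4"
    using B(2,3) Bochner_Integration.integrable_cong[OF refl, of unit_measure "\<lambda>x. (g x - g' x)\<^sup>2"]
      Bochner_Integration.integral_cong[OF refl, of unit_measure "\<lambda>x. (g x - g' x)\<^sup>2"]
    by (simp_all add: g')
  have "\<bar>g' x\<bar> \<le> B" for x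
    using B(1) by (auto simp: g'_def indicator_def)
  \<comment> \<open>Two nested uses of \<open>L2_close_trans\<close> cost a factor 4 each.\<close>
  moreover have "\<epsilon> / 16 > 0"
    using \<open>\<epsilon> > 0\<close> by simp
  ultimately obtain \<psi> a b where \<psi>: "continuous_on UNIV \<psi>" "0 < a" "a \<le> b" "b < 1"
    "\<And>x. x \<notin> {a..b} \<Longrightarrow> \<psi> x = 0"
    "integrable unit_measure (\<lambda>x. (g' x - \<psi> x)\<^sup>2)" "(\<integral>x. (g' x - \<psi> x)\<^sup>2 \<partial>unit_measure) < \<epsilon> / 16"
    using bounded_approx_continuous[OF g'm] by blast
  \<comment> \<open>Clamping the argument of \<sigma> to [a,b] makes the quotient continuous on the
    whole line; outside [a,b] the numerator is 0.\<close>
  define \<xi> where "\<xi> x = \<psi> x / \<sigma> (max a (min b x))" for x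
  have clamp: "max a (min b x) \<in> {0<..<1}" for x
    using \<psi>(2-4) by auto
  have "continuous_on UNIV \<xi>"
    unfolding \<xi>_def
  proof (intro continuous_on_divide \<psi>(1) continuous_on_compose2[OF \<sigma>(1)])
    show "\<forall>x\<in>UNIV. \<sigma> (max a (min b x)) \<noteq> 0"
      using clamp \<sigma>(2) by (metis greaterThanLessThan_iff less_irrefl)
    show "(\<lambda>x. max a (min b x)) ` UNIV \<subseteq> {0<..<1}"
      using clamp by auto
    show "continuous_on UNIV (\<lambda>x. max a (min b x))"
      by (intro continuous_on_max continuous_on_min continuous_on_const continuous_on_id)
  qed
  then have cont: "continuous_on {0..1} (\<lambda>t. \<xi> (sqrt t))"
    by (rule continuous_on_compose2[OF _ continuous_on_real_sqrt[OF continuous_on_id]]) auto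
  have \<psi>_eq: "\<psi> x = \<sigma> x * \<xi> x" if "0 < x" "x < 1" for x
    using \<sigma>(2)[OF that] \<psi>(5)[of x] by (cases "x \<in> {a..b}") (auto simp: \<xi>_def)
  define I where "I = (\<integral>x. (\<sigma> x)\<^sup>2 \<partial>unit_measure)"
  have "I \<ge> 0"
    unfolding I_def by simp
  \<comment> \<open>This gives \<delta>^2 I \<le> \<epsilon>/32, with I + 1 avoiding a division by
    0.\<close>
  define \<delta> where "\<delta> = sqrt (\<epsilon> / (32 * (I + 1)))"
  have "\<delta> > 0"
    using \<open>\<epsilon> > 0\<close> \<open>I \<ge> 0\<close> by (simp add: \<delta>_def)
  then obtain f where f: "real_polynomial_function f" "\<And>t. t \<in> {0..1} \<Longrightarrow> \<bar>\<xi> (sqrt t) - f t\<bar> < \<delta>"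
    using Stone_Weierstrass_real_polynomial_function[OF compact_Icc cont] by blast
  obtain c n where cn: "f = (\<lambda>t. \<Sum>i\<le>n. c i * t ^ i)"
    using f(1) by (auto simp: real_polynomial_function_iff_sum)
  define q where "q = (\<Sum>i\<le>n. monom (c i) i)"
  have q: "poly q t = f t" for t
    by (simp add: q_def cn poly_sum poly_monom)
  have le: "(\<psi> x - \<sigma> x * poly q (x\<^sup>2))\<^sup>2 \<le> \<delta>\<^sup>2 * (\<sigma> x)\<^sup>2" if "x \<in> space unit_measure" for x
  proof -
    have x: "0 < x" "x < 1"
      using that by auto
    have "\<bar>\<xi> (sqrt (x\<^sup>2)) - f (x\<^sup>2)\<bar> < \<delta>"
      using x by (intro f(2)) (auto simp: power_le_one)
    then have "\<bar>\<sigma> x * (\<xi> x - f (x\<^sup>2))\<bar> \<le> \<bar>\<sigma> x * \<delta>\<bar>"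
      using x \<open>\<delta> > 0\<close> unfolding abs_mult by (intro mult_left_mono) auto
    then have "(\<sigma> x * (\<xi> x - f (x\<^sup>2)))\<^sup>2 \<le> (\<sigma> x * \<delta>)\<^sup>2"
      by (simp only: abs_le_square_iff)
    then show ?thesis
      by (simp add: \<psi>_eq[OF x] q algebra_simps power_mult_distrib)
  qed
  have \<psi>m [measurable]: "\<psi> \<in> borel_measurable unit_measure"
    by (intro measurable_unit_measureI borel_measurable_continuous_onI \<psi>(1))
  have qm [measurable]: "(\<lambda>x. poly q (x\<^sup>2)) \<in> borel_measurable unit_measure"
    by (intro measurable_unit_measureI borel_measurable_continuous_onI continuous_on_poly
      continuous_on_power continuous_on_id)
  have g'um [measurable]: "g' \<in> borel_measurable unit_measure"
    by (intro measurable_unit_measureI g'm)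
  have dom: "integrable unit_measure (\<lambda>x. \<delta>\<^sup>2 * (\<sigma> x)\<^sup>2)"
    using \<sigma>_int by simp
  have int: "integrable unit_measure (\<lambda>x. (\<psi> x - \<sigma> x * poly q (x\<^sup>2))\<^sup>2)"
    by (rule Bochner_Integration.integrable_bound[OF dom]) (use le in \<open>auto intro!: AE_I2\<close>)
  have "(\<integral>x. (\<psi> x - \<sigma> x * poly q (x\<^sup>2))\<^sup>2 \<partial>unit_measure) \<le> (\<integral>x. \<delta>\<^sup>2 * (\<sigma> x)\<^sup>2 \<partial>unit_measure)"
    by (rule integral_mono[OF int dom le])
  also have "\<dots> = \<epsilon> / 32 * (I / (I + 1))"
    using \<open>I \<ge> 0\<close> \<open>\<epsilon> > 0\<close> by (simp add: \<delta>_def I_def[symmetric])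
  also have "\<dots> \<le> \<epsilon> / 32 * 1"
    using \<open>I \<ge> 0\<close> \<open>\<epsilon> > 0\<close> by (intro mult_left_mono) auto
  also have "\<dots> < \<epsilon> / 16"
    using \<open>\<epsilon> > 0\<close> by simp
  finally have small: "(\<integral>x. (\<psi> x - \<sigma> x * poly q (x\<^sup>2))\<^sup>2 \<partial>unit_measure) < \<epsilon> / 16" .
  have step2: "integrable unit_measure (\<lambda>x. (g' x - \<sigma> x * poly q (x\<^sup>2))\<^sup>2)"
    "(\<integral>x. (g' x - \<sigma> x * poly q (x\<^sup>2))\<^sup>2 \<partial>unit_measure) < \<epsilon> / 4"
    using L2_close_trans[of g' unit_measure \<psi> "\<lambda>x. \<sigma> x * poly q (x\<^sup>2)" "\<epsilon> / 4"] \<psi>(6,7) int small by auto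
  show thesis
    using that[of q] L2_close_trans[of g unit_measure g' "\<lambda>x. \<sigma> x * poly q (x\<^sup>2)" \<epsilon>] step1 step2 by auto
qed

section \<open>The three systems\<close>

text \<open>The counting function increases strictly along Z, hence uniqueness. Passing from R to
  the next element raises the count by exactly one, hence existence by induction.\<close>

lemma nth_element_ex1:
  fixes Z :: "real set"
  assumes inf: "infinite Z" and fin: "\<And>R. finite {z \<in> Z. z \<le> R}" and "n \<ge> 1"
  shows "\<exists>!x. x \<in> Z \<and> card {y \<in> Z. y \<le> x} = n"
proof (rule ex_ex1I)
  have less: "card {y \<in> Z. y \<le> u} < card {y \<in> Z. y \<le> v}" if "u < v" "v \<in> Z" for u v
  proof (rule psubset_card_mono[OF fin])
    have "{y \<in> Z. y \<le> u} \<subseteq> {y \<in> Z. y \<le> v}" "v \<notin> {y \<in> Z. y \<le> u}" "v \<in> {y \<in> Z. y \<le> v}"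
      using that by auto
    then show "{y \<in> Z. y \<le> u} \<subset> {y \<in> Z. y \<le> v}"
      by blast
  qed
  show "x = x'" if "x \<in> Z \<and> card {y \<in> Z. y \<le> x} = n" "x' \<in> Z \<and> card {y \<in> Z. y \<le> x'} = n" for x x'
    using less[of x x'] less[of x' x] that by (metis less_irrefl linorder_less_linear)
  have succ: "\<exists>x. x \<in> Z \<and> {y \<in> Z. y \<le> x} = insert x {y \<in> Z. y \<le> R} \<and> R < x" for R
  proof -
    have "infinite (Z - {z \<in> Z. z \<le> R})"
      using inf fin by (rule Diff_infinite_finite[rotated])
    then obtain z where z: "z \<in> Z" "R < z"
      by (metis (no_types, lifting) Diff_iff finite.emptyI equals0I linorder_not_le mem_Collect_eq)
    define S where "S = {y \<in> Z. R < y \<and> y \<le> z}"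
    have S: "finite S" "S \<noteq> {}"
      using finite_subset[OF _ fin[of z], of S] z by (auto simp: S_def)
    have m: "Min S \<in> S" "\<And>y. y \<in> S \<Longrightarrow> Min S \<le> y"
      using Min_in[OF S] Min_le[OF S(1)] by auto
    have "{y \<in> Z. y \<le> Min S} = insert (Min S) {y \<in> Z. y \<le> R}"
    proof (intro equalityI subsetI)
      fix y assume y: "y \<in> {y \<in> Z. y \<le> Min S}"
      show "y \<in> insert (Min S) {y \<in> Z. y \<le> R}"
      proof (cases "y \<le> R")
        case False
        then have "y \<in> S"
          using y m(1) by (auto simp: S_def)
        then show ?thesis
          using y m(2)[of y] by auto
      qed (use y in auto)
    qed (use m(1) in \<open>auto simp: S_def\<close>)
    then show ?thesis
      using m(1) by (intro exI[of _ "Min S"]) (auto simp: S_def)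
  qed
  show "\<exists>x. x \<in> Z \<and> card {y \<in> Z. y \<le> x} = n"
    using \<open>n \<ge> 1\<close>
  proof (induction n rule: dec_induct)
    case base
    obtain z where z: "z \<in> Z"
      using inf infinite_imp_nonempty by blast
    \<comment> \<open>A point below all of Z, so that its successor is the first element.\<close>
    define R where "R = Min {y \<in> Z. y \<le> z} - 1"
    have "Min {y \<in> Z. y \<le> z} \<le> y" if "y \<in> Z" for y
    proof (cases "y \<le> z")
      case False
      then show ?thesis
        using Min_le[OF fin, of z z] z by simp
    qed (use that in \<open>auto intro: Min_le[OF fin]\<close>)
    then have "{y \<in> Z. y \<le> R} = {}"
      by (force simp: R_def)
    then obtain x where "x \<in> Z" "{y \<in> Z. y \<le> x} = {x}"
      using succ[of R] by metis
    then show ?case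
      by (intro exI[of _ x]) simp
  next
    case (step n)
    then obtain u where u: "u \<in> Z" "card {y \<in> Z. y \<le> u} = n"
      by auto
    obtain x where x: "x \<in> Z" "{y \<in> Z. y \<le> x} = insert x {y \<in> Z. y \<le> u}" "u < x"
      using succ[of u] by blast
    then show ?case
      using u fin[of u] by (intro exI[of _ x]) auto
  qed
qed

text \<open>Multiplication by \<rho> maps L2 of the density \<rho>^2 isometrically to L2 of U and
  carries f to f0.\<close>

lemma complete_in_L2_density:
  fixes \<rho> w :: "'a \<Rightarrow> real"
  assumes comp: "complete_in_L2 U f0 I"
    and \<rho> [measurable]: "\<rho> \<in> borel_measurable U" and \<rho>_pos: "\<And>x. x \<in> space U \<Longrightarrow> 0 < \<rho> x"
    and w: "\<And>x. x \<in> space U \<Longrightarrow> w x = (\<rho> x)\<^sup>2"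
    and f: "\<And>i x. i \<in> I \<Longrightarrow> x \<in> space U \<Longrightarrow> f0 i x = \<rho> x * f i x"
  shows "complete_in_L2 (density U (\<lambda>x. ennreal (w x))) f I"
proof -
  let ?M = "density U (\<lambda>x. ennreal (w x))"
  have [measurable]: "w \<in> borel_measurable U"
    by (subst measurable_cong[OF w]) measurable
  have w_nonneg: "AE x in U. 0 \<le> w x"
    using w by auto
  have int_eq: "integrable ?M (\<lambda>x. (g x)\<^sup>2) \<longleftrightarrow> integrable U (\<lambda>x. (\<rho> x * g x)\<^sup>2)"
    and integral_eq: "(\<integral>x. (g x)\<^sup>2 \<partial>?M) = (\<integral>x. (\<rho> x * g x)\<^sup>2 \<partial>U)"
    if [measurable]: "g \<in> borel_measurable U" for g
  proof -
    have eq: "w x * (g x)\<^sup>2 = (\<rho> x * g x)\<^sup>2" if "x \<in> space U" for x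
      using w[OF that] by (simp add: power_mult_distrib)
    have "integrable ?M (\<lambda>x. (g x)\<^sup>2) \<longleftrightarrow> integrable U (\<lambda>x. w x * (g x)\<^sup>2)"
      using integrable_density[of "\<lambda>x. (g x)\<^sup>2" U w] w_nonneg by simp
    also have "\<dots> \<longleftrightarrow> integrable U (\<lambda>x. (\<rho> x * g x)\<^sup>2)"
      by (rule Bochner_Integration.integrable_cong[OF refl eq])
    finally show "integrable ?M (\<lambda>x. (g x)\<^sup>2) \<longleftrightarrow> integrable U (\<lambda>x. (\<rho> x * g x)\<^sup>2)" .
    have "(\<integral>x. (g x)\<^sup>2 \<partial>?M) = (\<integral>x. w x * (g x)\<^sup>2 \<partial>U)"
      using integral_density[of "\<lambda>x. (g x)\<^sup>2" U w] w_nonneg by simp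
    also have "\<dots> = (\<integral>x. (\<rho> x * g x)\<^sup>2 \<partial>U)"
      by (rule Bochner_Integration.integral_cong[OF refl eq])
    finally show "(\<integral>x. (g x)\<^sup>2 \<partial>?M) = (\<integral>x. (\<rho> x * g x)\<^sup>2 \<partial>U)" .
  qed
  have f0: "f0 i \<in> borel_measurable U" "integrable U (\<lambda>x. (f0 i x)\<^sup>2)" if "i \<in> I" for i
    using comp that by (auto simp: complete_in_L2_def L2_space_def)
  have fm: "f i \<in> borel_measurable U" if "i \<in> I" for i
  proof -
    have "f i x = f0 i x / \<rho> x" if "x \<in> space U" for x
      using f[OF \<open>i \<in> I\<close> that] \<rho>_pos[OF that] by simp
    moreover have "(\<lambda>x. f0 i x / \<rho> x) \<in> borel_measurable U"
      using f0(1)[OF that] by measurable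
    ultimately show ?thesis
      by (simp cong: measurable_cong)
  qed
  have mem: "f i \<in> L2_space ?M" if "i \<in> I" for i
  proof -
    have "integrable U (\<lambda>x. (\<rho> x * f i x)\<^sup>2)"
      using f0(2)[OF that] f[OF that]
        Bochner_Integration.integrable_cong[OF refl, of U "\<lambda>x. (f0 i x)\<^sup>2" "\<lambda>x. (\<rho> x * f i x)\<^sup>2"] by simp
    then show ?thesis
      using fm[OF that] int_eq[OF fm[OF that]] by (simp add: L2_space_def)
  qed
  have dense: "\<exists>h\<in>family_span f I. L2_norm ?M (\<lambda>x. g x - h x) < \<epsilon>" if g: "g \<in> L2_space ?M" and "\<epsilon> > 0" for g \<epsilon>
  proof -
    have gm [measurable]: "g \<in> borel_measurable U"
      using g by (simp add: L2_space_def)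
    have "(\<lambda>x. \<rho> x * g x) \<in> borel_measurable U"
      by measurable
    then have "(\<lambda>x. \<rho> x * g x) \<in> L2_space U"
      using g int_eq[OF gm] by (simp add: L2_space_def)
    with comp have "\<forall>\<epsilon>>0. \<exists>h\<in>family_span f0 I. L2_norm U (\<lambda>x. \<rho> x * g x - h x) < \<epsilon>"
      unfolding complete_in_L2_def by (elim conjE bspec)
    then obtain h0 where h0: "h0 \<in> family_span f0 I" "L2_norm U (\<lambda>x. \<rho> x * g x - h0 x) < \<epsilon>"
      using \<open>\<epsilon> > 0\<close> by meson
    then obtain A c where A: "finite A" "A \<subseteq> I" "h0 = (\<lambda>x. \<Sum>i\<in>A. c i * f0 i x)"
      by (auto simp: family_span_def)
    define h where "h = (\<lambda>x. \<Sum>i\<in>A. c i * f i x)"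
    have "h \<in> family_span f I"
      using A by (auto simp: family_span_def h_def)
    moreover have hm [measurable]: "h \<in> borel_measurable U"
      unfolding h_def using A(2) fm by (intro borel_measurable_sum borel_measurable_times) auto
    have "\<rho> x * (g x - h x) = \<rho> x * g x - h0 x" if "x \<in> space U" for x
      using A f that by (simp add: h_def right_diff_distrib sum_distrib_left subset_iff mult.left_commute
        cong: sum.cong)
    then have "(\<integral>x. (\<rho> x * (g x - h x))\<^sup>2 \<partial>U) = (\<integral>x. (\<rho> x * g x - h0 x)\<^sup>2 \<partial>U)"
      by (intro Bochner_Integration.integral_cong) auto
    then have "L2_norm ?M (\<lambda>x. g x - h x) < \<epsilon>"
      using h0(2) integral_eq[of "\<lambda>x. g x - h x"] by (simp add: L2_norm_def)
    ultimately show ?thesis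
      by blast
  qed
  show ?thesis
    using mem dense by (auto simp: complete_in_L2_def)
qed

lemma poly_antiderivative_ex: "\<exists>p. pderiv p = (q :: real poly)"
proof
  let ?p = "\<Sum>i\<le>degree q. monom (coeff q i / real (Suc i)) (Suc i)"
  have "pderiv (\<Sum>i\<in>I. r i) = (\<Sum>i\<in>I. pderiv (r i))" for I :: "nat set" and r :: "nat \<Rightarrow> real poly"
    by (induction I rule: infinite_finite_induct) (auto simp: pderiv_add)
  then have "pderiv ?p = (\<Sum>i\<le>degree q. monom (coeff q i) i)"
    by (simp add: pderiv_monom del: of_nat_Suc)
  then show "pderiv ?p = q"
    by (simp add: poly_as_sum_of_monoms)
qed

section \<open>From power series back to Bessel functions\<close>

context bessel_index
begin

lemma Gamma_shift: "Gamma (real k + \<nu> + 1) = pochhammer (\<nu> + 1) k * Gamma (\<nu> + 1)"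
proof -
  have "\<nu> + 1 > 0"
    using nu by simp
  then have "\<nu> + 1 \<notin> \<int>\<^sub>\<le>\<^sub>0" "Gamma (\<nu> + 1) > 0"
    by (auto elim!: nonpos_Ints_cases intro: Gamma_real_pos)
  then show ?thesis
    using pochhammer_Gamma[of "\<nu> + 1" k] by (simp add: field_simps)
qed

lemma Gamma_pos: "Gamma (\<nu> + 1) > 0"
  using nu by (intro Gamma_real_pos) simp

lemma powr_two_nat:
  fixes y :: real
  assumes "y > 0"
  shows "y powr (2 * real k + a) = y powr a * (y\<^sup>2) ^ k"
proof -
  have "y powr (2 * real k) = y powr real (2 * k)"
    by simp
  also have "\<dots> = (y\<^sup>2) ^ k"
    unfolding powr_realpow[OF assms] power_mult ..
  finally show ?thesis
    by (simp add: powr_add)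
qed

lemma bessel_J_eq:
  assumes "x > 0"
  shows "bessel_J \<nu> x = (x / 2) powr \<nu> / Gamma (\<nu> + 1) * eval_fps bess ((x / 2)\<^sup>2)"
proof -
  have "(- 1) ^ k / (fact k * Gamma (real k + \<nu> + 1)) * (x / 2) powr (2 * real k + \<nu>) =
      (x / 2) powr \<nu> / Gamma (\<nu> + 1) * (fps_nth bess k * ((x / 2)\<^sup>2) ^ k)" for k
    using powr_two_nat[of "x / 2" k \<nu>] assms by (simp add: Gamma_shift bess_nth \<tau>_def mult_ac)
  moreover have "summable (\<lambda>k. fps_nth bess k * ((x / 2)\<^sup>2) ^ k)"
    using entire_sums[OF entire_bess] by (rule sums_summable)
  ultimately show ?thesis
    unfolding bessel_J_def eval_fps_def by (simp only: suminf_mult)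
qed

text \<open>The relation (x^(-\<nu>) J_\<nu>)' = - x^(-\<nu>) J_(\<nu>+1), obtained by comparing
  coefficients.\<close>

lemma bessel_J_Suc_eq:
  assumes "x > 0"
  shows "bessel_J (\<nu> + 1) x = - ((x / 2) powr (\<nu> + 1)) / Gamma (\<nu> + 1) * eval_fps (fps_deriv bess) ((x / 2)\<^sup>2)"
proof -
  have "(- 1) ^ k / (fact k * Gamma (real k + (\<nu> + 1) + 1)) * (x / 2) powr (2 * real k + (\<nu> + 1)) =
      - ((x / 2) powr (\<nu> + 1)) / Gamma (\<nu> + 1) * (fps_nth (fps_deriv bess) k * ((x / 2)\<^sup>2) ^ k)" for k
  proof -
    have "Gamma (real k + (\<nu> + 1) + 1) = pochhammer (\<nu> + 1) (Suc k) * Gamma (\<nu> + 1)"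
      using Gamma_shift[of "Suc k"] by (simp add: add_ac)
    moreover have "fps_nth (fps_deriv bess) k = (- \<tau> k) / (real k + \<nu> + 1)"
      by (simp add: bess_nth \<tau>_Suc del: of_nat_Suc)
    ultimately show ?thesis
      using powr_two_nat[of "x / 2" k "\<nu> + 1"] assms
      by (simp add: \<tau>_def pochhammer_Suc add_ac mult_ac)
  qed
  moreover have "summable (\<lambda>k. fps_nth (fps_deriv bess) k * ((x / 2)\<^sup>2) ^ k)"
    using entire_sums[OF entire_deriv[OF entire_bess]] by (rule sums_summable)
  ultimately show ?thesis
    unfolding bessel_J_def eval_fps_def by (simp only: suminf_mult)
qed

section \<open>Enumeration of the positive zeros\<close>

definition Jzeros :: "real set" where
  "Jzeros = {x. 0 < x \<and> bessel_J \<nu> x = 0}"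

lemma Jzeros_iff: "x \<in> Jzeros \<longleftrightarrow> 0 < x \<and> (x / 2)\<^sup>2 \<in> zeros"
  using Gamma_pos by (auto simp: Jzeros_def zeros_def bessel_J_eq)

lemma zeros_Jzeros: "w \<in> zeros \<Longrightarrow> 2 * sqrt w \<in> Jzeros"
  by (simp add: Jzeros_iff) (simp add: zeros_def)

lemma finite_Jzeros_le: "finite {x \<in> Jzeros. x \<le> R}"
proof (rule finite_subset)
  show "finite ((\<lambda>w. 2 * sqrt w) ` {w \<in> zeros. w \<le> (R / 2)\<^sup>2})"
    by (intro finite_imageI finite_zeros_le)
  show "{x \<in> Jzeros. x \<le> R} \<subseteq> (\<lambda>w. 2 * sqrt w) ` {w \<in> zeros. w \<le> (R / 2)\<^sup>2}"
  proof
    fix x assume x: "x \<in> {x \<in> Jzeros. x \<le> R}"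
    then have "0 < x" "(x / 2)\<^sup>2 \<in> zeros" "(x / 2)\<^sup>2 \<le> (R / 2)\<^sup>2"
      by (auto simp: Jzeros_iff intro!: power_mono)
    then show "x \<in> (\<lambda>w. 2 * sqrt w) ` {w \<in> zeros. w \<le> (R / 2)\<^sup>2}"
      by (intro image_eqI[of _ _ "(x / 2)\<^sup>2"]) auto
  qed
qed

lemma infinite_Jzeros: "infinite Jzeros"
proof
  assume "finite Jzeros"
  moreover have "zeros \<subseteq> (\<lambda>x. (x / 2)\<^sup>2) ` Jzeros"
  proof
    fix w assume w: "w \<in> zeros"
    then show "w \<in> (\<lambda>x. (x / 2)\<^sup>2) ` Jzeros"
      by (intro image_eqI[of _ _ "2 * sqrt w"] zeros_Jzeros) (auto simp: zeros_def)
  qed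
  ultimately show False
    using infinite_zeros finite_subset by blast
qed

lemma bessel_zero_alt:
  "bessel_zero \<nu> n = (THE x. x \<in> Jzeros \<and> card {y \<in> Jzeros. y \<le> x} = n)"
proof -
  have "{y. 0 < y \<and> y \<le> x \<and> bessel_J \<nu> y = 0} = {y \<in> Jzeros. y \<le> x}" for x
    by (auto simp: Jzeros_def)
  then show ?thesis
    unfolding bessel_zero_def by (simp add: Jzeros_def)
qed

lemma bessel_zero:
  assumes "n \<ge> 1"
  shows "bessel_zero \<nu> n \<in> Jzeros" "card {y \<in> Jzeros. y \<le> bessel_zero \<nu> n} = n"
  using theI'[OF nth_element_ex1[OF infinite_Jzeros finite_Jzeros_le assms]]
  unfolding bessel_zero_alt by auto

lemma bessel_zero_surj:
  assumes "z \<in> Jzeros"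
  obtains n where "n \<ge> 1" "bessel_zero \<nu> n = z"
proof
  let ?n = "card {y \<in> Jzeros. y \<le> z}"
  show n: "?n \<ge> 1"
    using assms finite_Jzeros_le[of z] by (auto simp: Suc_le_eq card_gt_0_iff)
  show "bessel_zero \<nu> ?n = z"
    unfolding bessel_zero_alt
    by (rule the1_equality[OF nth_element_ex1[OF infinite_Jzeros finite_Jzeros_le n]]) (use assms in auto)
qed

text \<open>The eigenvalue of \<open>opA\<close> that belongs to the frequency
  \<open>bessel_zero \<nu> n\<close>.\<close>

definition wzero :: "nat \<Rightarrow> real" where
  "wzero n = (bessel_zero \<nu> n / 2)\<^sup>2"

lemma wzero_in: "n \<ge> 1 \<Longrightarrow> wzero n \<in> zeros"
  using bessel_zero(1) by (simp add: wzero_def Jzeros_iff)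

lemma bessel_zero_pos: "n \<ge> 1 \<Longrightarrow> 0 < bessel_zero \<nu> n"
  using bessel_zero(1)[of n] by (simp add: Jzeros_iff)

text \<open>Turns finite sets of eigenvalues back into finite sets of indices.\<close>

lemma wzero_surj:
  assumes "w \<in> zeros"
  obtains n where "n \<ge> 1" "wzero n = w"
proof -
  obtain n where "n \<ge> 1" "bessel_zero \<nu> n = 2 * sqrt w"
    using bessel_zero_surj[OF zeros_Jzeros[OF assms]] by blast
  then show thesis
    using that assms by (auto simp: wzero_def zeros_def)
qed

text \<open>A smaller eigenvalue would put two zeros into a set that has one element by
  definition.\<close>

lemma wzero_1: "wzero 1 = first_zero"
proof (rule antisym)
  show "first_zero \<le> wzero 1"
    by (intro first_zero(2) wzero_in) simp
  show "wzero 1 \<le> first_zero"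
  proof (rule ccontr)
    assume "\<not> wzero 1 \<le> first_zero"
    define z where "z = 2 * sqrt first_zero"
    have z: "z \<in> Jzeros"
      unfolding z_def by (intro zeros_Jzeros first_zero)
    have "(z / 2)\<^sup>2 < (bessel_zero \<nu> 1 / 2)\<^sup>2"
      using \<open>\<not> wzero 1 \<le> first_zero\<close> first_zero_pos by (simp add: z_def wzero_def)
    then have less: "z < bessel_zero \<nu> 1"
      using power2_less_imp_less[of "z / 2" "bessel_zero \<nu> 1 / 2"] bessel_zero_pos[of 1] by simp
    have "card {z, bessel_zero \<nu> 1} \<le> card {y \<in> Jzeros. y \<le> bessel_zero \<nu> 1}"
      using z less bessel_zero(1)[of 1] by (intro card_mono finite_Jzeros_le) auto
    then show False
      using less bessel_zero(2)[of 1] by simp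
  qed
qed

text \<open>The constant ratio between \<open>phi \<nu> n\<close> and the eigenfunction normalised
  to be 1 at the origin; its positivity suffices, as spans absorb scaling.\<close>

definition nrm :: "nat \<Rightarrow> real" where
  "nrm n = sqrt 2 / \<bar>bessel_J (\<nu> + 1) (bessel_zero \<nu> n)\<bar> * ((bessel_zero \<nu> n / 2) powr \<nu> / Gamma (\<nu> + 1))"

lemma nrm_pos:
  assumes "n \<ge> 1"
  shows "nrm n > 0"
proof -
  have "eval_fps (fps_deriv bess) (wzero n) \<noteq> (0 :: real)"
    using wzero_in[OF assms] by (intro simple_zero(2)) (auto simp: zeros_def)
  then have "bessel_J (\<nu> + 1) (bessel_zero \<nu> n) \<noteq> 0"
    using bessel_zero_pos[OF assms] Gamma_pos by (simp add: bessel_J_Suc_eq wzero_def)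
  then show ?thesis
    using bessel_zero_pos[OF assms] Gamma_pos by (simp add: nrm_def)
qed

lemma phi_eq:
  assumes "n \<ge> 1" "x > 0"
  shows "phi \<nu> n x = nrm n * eval_fps (eigen (wzero n)) (x\<^sup>2)"
proof -
  have l: "bessel_zero \<nu> n > 0"
    by (rule bessel_zero_pos[OF assms(1)])
  have "x powr (- \<nu>) * (bessel_zero \<nu> n * x / 2) powr \<nu> = (bessel_zero \<nu> n / 2) powr \<nu>"
    using l assms(2) powr_mult[of "bessel_zero \<nu> n / 2" x \<nu>]
    by (simp add: powr_minus field_simps)
  moreover have "bessel_J \<nu> (bessel_zero \<nu> n * x) = (bessel_zero \<nu> n * x / 2) powr \<nu> / Gamma (\<nu> + 1) *
      eval_fps (eigen (wzero n)) (x\<^sup>2)"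
    using l assms(2) by (subst bessel_J_eq) (auto simp: eval_eigen wzero_def power_mult_distrib power_divide)
  ultimately show ?thesis
    unfolding phi_def nrm_def by (simp add: mult.assoc)
qed

lemma phi_has_derivative:
  assumes "n \<ge> 1" "x > 0"
  shows "(phi \<nu> n has_real_derivative nrm n * (eval_fps (fps_deriv (eigen (wzero n))) (x\<^sup>2) * (2 * x))) (at x)"
proof (rule has_field_derivative_transform_within_open)
  show "((\<lambda>x. nrm n * eval_fps (eigen (wzero n)) (x\<^sup>2)) has_real_derivative
      nrm n * (eval_fps (fps_deriv (eigen (wzero n))) (x\<^sup>2) * (2 * x))) (at x)"
    by (intro DERIV_cmult entire_has_derivative_square) simp
  show "open {0::real<..}" "x \<in> {0<..}"
    using assms(2) by auto
  show "nrm n * eval_fps (eigen (wzero n)) (y\<^sup>2) = phi \<nu> n y" if "y \<in> {0<..}" for y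
    using that assms(1) by (simp add: phi_eq)
qed

lemma phi_1_eq: "x > 0 \<Longrightarrow> phi \<nu> 1 x = nrm 1 * eval_fps ground (x\<^sup>2)"
  using phi_eq[of 1 x] by (simp add: wzero_1[simplified] ground_def)

lemma phi_1_pos:
  assumes "0 < x" "x < 1"
  shows "phi \<nu> 1 x > 0"
  unfolding phi_1_eq[OF assms(1)]
  using nrm_pos[of 1] ground_pos[of "x\<^sup>2"] assms by (simp add: power_less_one_iff abs_square_less_1)

text \<open>The right side is minus the logarithmic derivative in x of the first
  eigenfunction.\<close>

lemma R_fun_eq:
  assumes "0 < x" "x < 1"
  shows "R_fun \<nu> x = - 2 * x * eval_fps (fps_deriv ground) (x\<^sup>2) / eval_fps ground (x\<^sup>2)"
proof -
  define l where "l = bessel_zero \<nu> 1"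
  have l: "l > 0" "(l / 2)\<^sup>2 = first_zero"
    using bessel_zero_pos[of 1] wzero_1 by (auto simp: l_def wzero_def)
  define y where "y = l * x / 2"
  have y: "y > 0" "l * x > 0"
    using l assms by (auto simp: y_def)
  have y2: "y\<^sup>2 = first_zero * x\<^sup>2"
    unfolding l(2)[symmetric] by (simp add: y_def power_mult_distrib power_divide)
  have g: "eval_fps ground (x\<^sup>2) = eval_fps bess (y\<^sup>2)"
    by (simp add: ground_def eval_eigen y2)
  have g': "eval_fps (fps_deriv ground) (x\<^sup>2) = first_zero * eval_fps (fps_deriv bess) (y\<^sup>2)"
    by (simp add: ground_def eval_deriv_eigen y2)
  have gp: "eval_fps bess (y\<^sup>2) > 0"
    using ground_pos[of "x\<^sup>2"] assms by (simp add: g power_less_one_iff abs_square_less_1)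
  have J0: "bessel_J \<nu> (l * x) = y powr \<nu> / Gamma (\<nu> + 1) * eval_fps bess (y\<^sup>2)"
    unfolding bessel_J_eq[OF y(2)] y_def ..
  have J1: "bessel_J (\<nu> + 1) (l * x) = - (y powr \<nu> * y) / Gamma (\<nu> + 1) * eval_fps (fps_deriv bess) (y\<^sup>2)"
    unfolding bessel_J_Suc_eq[OF y(2)] y_def[symmetric] using y by (simp add: powr_add)
  have "R_fun \<nu> x = - (l * y) * eval_fps (fps_deriv bess) (y\<^sup>2) / eval_fps bess (y\<^sup>2)"
    unfolding R_fun_def l_def[symmetric] J0 J1 using y Gamma_pos gp by (simp add: field_simps)
  moreover have "l * y = 2 * x * first_zero"
    unfolding l(2)[symmetric] y_def by (simp add: power2_eq_square)
  ultimately show ?thesis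
    unfolding g g' by (simp add: mult_ac)
qed

lemma delta_op_phi:
  assumes "n \<ge> 1" "0 < x" "x < 1"
  shows "delta_op \<nu> (phi \<nu> n) x = nrm n * darboux (eigen (wzero n)) x"
  unfolding delta_op_def DERIV_imp_deriv[OF phi_has_derivative[OF assms(1,2)]] R_fun_eq[OF assms(2,3)]
    phi_eq[OF assms(1,2)] darboux_def
  by (simp add: algebra_simps)

text \<open>The term with (\<nu> + 1/2) / x cancels the derivative of the factor
  x^(\<nu>+1/2).\<close>

lemma D_op_psi:
  assumes "n \<ge> 1" "0 < x" "x < 1"
  shows "D_op \<nu> (psi \<nu> n) x = x powr (\<nu> + 1 / 2) * delta_op \<nu> (phi \<nu> n) x"
proof -
  define d where "d = nrm n * (eval_fps (fps_deriv (eigen (wzero n))) (x\<^sup>2) * (2 * x))"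
  have d: "(phi \<nu> n has_real_derivative d) (at x)"
    unfolding d_def by (rule phi_has_derivative[OF assms(1,2)])
  have "(psi \<nu> n has_real_derivative
      (\<nu> + 1 / 2) * x powr (\<nu> + 1 / 2 - 1) * phi \<nu> n x + d * x powr (\<nu> + 1 / 2)) (at x)"
    unfolding psi_def[abs_def] by (rule DERIV_mult[OF has_real_derivative_powr[OF assms(2)] d])
  moreover have "x powr (\<nu> + 1 / 2 - 1) = x powr (\<nu> + 1 / 2) / x"
    using assms(2) powr_diff[of x "\<nu> + 1 / 2" 1] by simp
  ultimately have "deriv (psi \<nu> n) x =
      (\<nu> + 1 / 2) / x * psi \<nu> n x + x powr (\<nu> + 1 / 2) * d"
    by (simp add: DERIV_imp_deriv psi_def)
  then show ?thesis
    unfolding D_op_def delta_op_def DERIV_imp_deriv[OF d] by (simp add: psi_def distrib_left)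
qed

lemma phi_1_log_derivative:
  assumes "0 < x" "x < 1"
  shows "(phi \<nu> 1 has_real_derivative - R_fun \<nu> x * phi \<nu> 1 x) (at x)"
proof -
  have "eval_fps ground (x\<^sup>2) > 0"
    using ground_pos[of "x\<^sup>2"] assms by (simp add: power_less_one_iff abs_square_less_1)
  then have "nrm 1 * (eval_fps (fps_deriv (eigen (wzero 1))) (x\<^sup>2) * (2 * x)) = - R_fun \<nu> x * phi \<nu> 1 x"
    unfolding R_fun_eq[OF assms] phi_1_eq[OF assms(1)] by (simp add: wzero_1[simplified] ground_def)
  then show ?thesis
    using phi_has_derivative[of 1 x] assms by simp
qed

text \<open>Quotient rule, with the derivative of the denominator given by
  \<open>phi_1_log_derivative\<close>.\<close>

lemma d_op_varphi:
  assumes "n \<ge> 1" "0 < x" "x < 1"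
  shows "phi \<nu> 1 x * d_op \<nu> (varphi \<nu> n) x = delta_op \<nu> (phi \<nu> n) x"
proof -
  define d where "d = nrm n * (eval_fps (fps_deriv (eigen (wzero n))) (x\<^sup>2) * (2 * x))"
  have d: "(phi \<nu> n has_real_derivative d) (at x)"
    unfolding d_def by (rule phi_has_derivative[OF assms(1,2)])
  have p: "phi \<nu> 1 x > 0"
    by (rule phi_1_pos[OF assms(2,3)])
  have "(varphi \<nu> n has_real_derivative
      (d * phi \<nu> 1 x - phi \<nu> n x * (- R_fun \<nu> x * phi \<nu> 1 x)) / (phi \<nu> 1 x * phi \<nu> 1 x)) (at x)"
    unfolding varphi_def[abs_def]
    by (rule DERIV_divide[OF d phi_1_log_derivative[OF assms(2,3)]]) (use p in simp)
  then have "d_op \<nu> (varphi \<nu> n) x =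
      (d * phi \<nu> 1 x - phi \<nu> n x * (- R_fun \<nu> x * phi \<nu> 1 x)) / (phi \<nu> 1 x * phi \<nu> 1 x)"
    unfolding d_op_def by (rule DERIV_imp_deriv)
  also have "d * phi \<nu> 1 x - phi \<nu> n x * (- R_fun \<nu> x * phi \<nu> 1 x) =
      phi \<nu> 1 x * (d + R_fun \<nu> x * phi \<nu> n x)"
    by (simp add: algebra_simps)
  finally show ?thesis
    unfolding delta_op_def DERIV_imp_deriv[OF d] using p by simp
qed

section \<open>Completeness of the three systems\<close>

lemma measurable_on_unit:
  fixes f :: "real \<Rightarrow> real"
  assumes "continuous_on {0<..<1} f"
  shows "f \<in> borel_measurable unit_measure"
  using borel_measurable_continuous_on_restrict[OF assms] sets_unit_measure
  by (simp cong: measurable_cong_sets)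

lemma continuous_on_powr_unit: "continuous_on {0<..<1 :: real} (\<lambda>x. x powr a)"
  by (rule DERIV_continuous_on[OF DERIV_subset[OF has_real_derivative_powr]]) auto

lemma continuous_on_darboux:
  assumes "entire F"
  shows "continuous_on {0<..<1} (darboux F)"
proof -
  have "eval_fps ground (x\<^sup>2) \<noteq> 0" if "x \<in> {0<..<1}" for x
    using ground_pos[of "x\<^sup>2"] that by (auto simp: power_less_one_iff abs_square_less_1)
  then show ?thesis
    unfolding darboux_def[abs_def] using assms
    by (intro continuous_on_mult continuous_on_diff continuous_on_divide entire_continuous_on_square
      continuous_on_const continuous_on_id) auto
qed

lemma powr_half_square: "x > 0 \<Longrightarrow> (x powr (\<nu> + 1 / 2))\<^sup>2 = x powr (2 * \<nu> + 1)"
  by (simp add: power2_eq_square flip: powr_add)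

text \<open>g is approximated first by the image of \<open>ground\<close> times an even polynomial,
  then by the image of a partial sum of its eigenfunction expansion. The other two systems are
  reduced to this one by a change of weight.\<close>

lemma complete_D_op: "complete_in_L2 unit_measure (\<lambda>n. D_op \<nu> (psi \<nu> n)) {2..}"
proof -
  define \<rho> where "\<rho> x = x powr (\<nu> + 1 / 2)" for x :: real
  have \<rho>_cont: "continuous_on {0<..<1} \<rho>"
    unfolding \<rho>_def by (rule continuous_on_powr_unit)
  have \<rho>_sq: "(\<rho> x * y)\<^sup>2 = x powr (2 * \<nu> + 1) * y\<^sup>2" if "x \<in> space unit_measure" for x y
    using that powr_half_square[of x] by (simp add: \<rho>_def power_mult_distrib)
  have \<rho>_darboux: "(\<lambda>x. \<rho> x * darboux F x) \<in> borel_measurable unit_measure"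
    "integrable unit_measure (\<lambda>x. (\<rho> x * darboux F x)\<^sup>2)"
    "(\<integral>x. (\<rho> x * darboux F x)\<^sup>2 \<partial>unit_measure) = (\<integral>x. x powr (2 * \<nu> + 1) * (darboux F x)\<^sup>2 \<partial>unit_measure)"
    if "entire F" "eval_fps F 1 = 0" for F
  proof -
    show "(\<lambda>x. \<rho> x * darboux F x) \<in> borel_measurable unit_measure"
      using that by (intro measurable_on_unit continuous_on_mult \<rho>_cont continuous_on_darboux)
    show "integrable unit_measure (\<lambda>x. (\<rho> x * darboux F x)\<^sup>2)"
      using darboux_energy(1)[OF that] \<rho>_sq
        Bochner_Integration.integrable_cong[OF refl, of unit_measure "\<lambda>x. (\<rho> x * darboux F x)\<^sup>2"] by simp
    show "(\<integral>x. (\<rho> x * darboux F x)\<^sup>2 \<partial>unit_measure) = (\<integral>x. x powr (2 * \<nu> + 1) * (darboux F x)\<^sup>2 \<partial>unit_measure)"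
      by (rule Bochner_Integration.integral_cong[OF refl \<rho>_sq])
  qed
  have system: "D_op \<nu> (psi \<nu> n) x = nrm n * (\<rho> x * darboux (eigen (wzero n)) x)"
    if "n \<ge> 1" "x \<in> space unit_measure" for n x
    using that by (simp add: D_op_psi delta_op_phi \<rho>_def)
  have mem: "D_op \<nu> (psi \<nu> n) \<in> L2_space unit_measure" if "n \<in> {2..}" for n
  proof -
    have n: "n \<ge> 1"
      using that by simp
    have e: "entire (eigen (wzero n))" "eval_fps (eigen (wzero n)) 1 = 0"
      using wzero_in[OF n] by (auto simp: eval_eigen_1 zeros_def)
    have "(\<lambda>x. nrm n * (\<rho> x * darboux (eigen (wzero n)) x)) \<in> borel_measurable unit_measure"
      using \<rho>_darboux(1)[OF e] by measurable
    then have "D_op \<nu> (psi \<nu> n) \<in> borel_measurable unit_measure"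
      by (subst measurable_cong[OF system[OF n]])
    moreover have "integrable unit_measure (\<lambda>x. (nrm n * (\<rho> x * darboux (eigen (wzero n)) x))\<^sup>2)"
      using \<rho>_darboux(2)[OF e] unfolding power_mult_distrib[of "nrm n"] by (rule integrable_mult_right)
    then have "integrable unit_measure (\<lambda>x. (D_op \<nu> (psi \<nu> n) x)\<^sup>2)"
      using Bochner_Integration.integrable_cong[OF refl, of unit_measure "\<lambda>x. (D_op \<nu> (psi \<nu> n) x)\<^sup>2"]
        system[OF n] by simp
    ultimately show ?thesis
      by (simp add: L2_space_def)
  qed
  have dense: "\<exists>h\<in>family_span (\<lambda>n. D_op \<nu> (psi \<nu> n)) {2..}. L2_norm unit_measure (\<lambda>x. g x - h x) < \<epsilon>"
    if g: "g \<in> L2_space unit_measure" and "\<epsilon> > 0" for g \<epsilon>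
  proof -
    have \<epsilon>: "\<epsilon>\<^sup>2 / 4 > 0"
      using \<open>\<epsilon> > 0\<close> by simp
    \<comment> \<open>With this weight, \<sigma>(x) q(x^2) is \<rho> times
      \<open>darboux (ground * p)\<close> whenever p' = q.\<close>
    define \<sigma> where "\<sigma> x = \<rho> x * (2 * x * eval_fps ground (x\<^sup>2))" for x
    have \<sigma>_cont: "continuous_on {0<..<1} \<sigma>"
      unfolding \<sigma>_def
      by (intro continuous_on_mult \<rho>_cont entire_continuous_on_square continuous_on_const continuous_on_id) simp
    have \<sigma>_pos: "0 < \<sigma> x" if "0 < x" "x < 1" for x
      using ground_pos[of "x\<^sup>2"] that
      by (simp add: \<sigma>_def \<rho>_def power_less_one_iff abs_square_less_1)
    have "integrable unit_measure (\<lambda>x. x powr (2 * \<nu> + 1) *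
        eval_fps (fps_const 4 * fps_X * (ground * ground)) (x\<^sup>2))"
      by (intro wint_integrable) simp
    moreover have "(\<sigma> x)\<^sup>2 = x powr (2 * \<nu> + 1) * eval_fps (fps_const 4 * fps_X * (ground * ground)) (x\<^sup>2)"
      if "x \<in> space unit_measure" for x
      unfolding \<sigma>_def \<rho>_sq[OF that] by (simp add: power2_eq_square)
    ultimately have \<sigma>_int: "integrable unit_measure (\<lambda>x. (\<sigma> x)\<^sup>2)"
      using Bochner_Integration.integrable_cong[OF refl, of unit_measure "\<lambda>x. (\<sigma> x)\<^sup>2"] by simp
    obtain q where q: "integrable unit_measure (\<lambda>x. (g x - \<sigma> x * poly q (x\<^sup>2))\<^sup>2)"
      "(\<integral>x. (g x - \<sigma> x * poly q (x\<^sup>2))\<^sup>2 \<partial>unit_measure) < \<epsilon>\<^sup>2 / 4"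
      by (rule weighted_even_polynomials_dense[OF g \<epsilon> \<sigma>_cont \<sigma>_pos \<sigma>_int])
    obtain p where p: "pderiv p = q"
      using poly_antiderivative_ex by blast
    define f where "f = ground * fps_of_poly p"
    have f: "entire f" "eval_fps f 1 = 0"
      by (simp_all add: f_def ground_1)
    have \<rho>f: "\<sigma> x * poly q (x\<^sup>2) = \<rho> x * darboux f x" if "x \<in> space unit_measure" for x
      using that by (simp add: f_def \<sigma>_def darboux_ground_mult fps_of_poly_pderiv[symmetric] p)
    obtain Z where Z: "finite Z" "Z \<subseteq> zeros"
      "(\<integral>x. x powr (2 * \<nu> + 1) * (darboux (f - partial f Z) x)\<^sup>2 \<partial>unit_measure) < \<epsilon>\<^sup>2 / 4"
      by (rule darboux_resid_small[OF f \<epsilon>])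
    have pf1: "eval_fps (partial f Z) 1 = 0"
      unfolding partial_def using Z
      by (subst eval_entire_sum) (auto intro!: sum.neutral simp: eval_eigen_1 zeros_def)
    define ix where "ix w = (SOME n. n \<ge> 1 \<and> wzero n = w)" for w
    have ix: "ix w \<ge> 1" "wzero (ix w) = w" if "w \<in> zeros" for w
      unfolding ix_def using someI_ex[of "\<lambda>n. n \<ge> 1 \<and> wzero n = w"] wzero_surj[OF that] by blast+
    define A where "A = ix ` (Z - {first_zero})"
    define h where "h x = (\<Sum>n\<in>A. fcoef f (wzero n) / nrm n * D_op \<nu> (psi \<nu> n) x)" for x
    \<comment> \<open>The index 1 belongs to \<open>first_zero\<close>, which has been
      removed.\<close>
    have "ix w \<ge> 2" if "w \<in> Z - {first_zero}" for w
    proof (rule ccontr)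
      assume "\<not> ix w \<ge> 2"
      then have "ix w = 1"
        using ix(1)[of w] that Z(2) by auto
      then show False
        using ix(2)[of w] that Z(2) wzero_1 by auto
    qed
    then have A: "finite A" "A \<subseteq> {2..}"
      using Z(1) by (auto simp: A_def)
    then have span: "h \<in> family_span (\<lambda>n. D_op \<nu> (psi \<nu> n)) {2..}"
      unfolding family_span_def h_def[abs_def]
      by (intro CollectI exI[of _ A] exI[of _ "\<lambda>n. fcoef f (wzero n) / nrm n"]) auto
    have inj: "inj_on ix (Z - {first_zero})"
      using ix(2) Z(2) by (intro inj_onI) (metis DiffD1 subsetD)
    have h_eq: "h x = \<rho> x * darboux (partial f Z) x" if x: "x \<in> space unit_measure" for x
    proof -
      have "h x = (\<Sum>n\<in>A. fcoef f (wzero n) * (\<rho> x * darboux (eigen (wzero n)) x))"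
        unfolding h_def
      proof (rule sum.cong)
        fix n assume "n \<in> A"
        then have "n \<ge> 1"
          using A(2) by auto
        then show "fcoef f (wzero n) / nrm n * D_op \<nu> (psi \<nu> n) x =
            fcoef f (wzero n) * (\<rho> x * darboux (eigen (wzero n)) x)"
          using nrm_pos[of n] by (simp add: system[OF _ x])
      qed simp
      also have "\<dots> = (\<Sum>w\<in>Z - {first_zero}. fcoef f w * (\<rho> x * darboux (eigen w) x))"
        unfolding A_def sum.reindex[OF inj] using ix(2) Z(2)
        by (intro sum.cong) (auto simp: subset_iff)
      \<comment> \<open>Putting \<open>first_zero\<close> back changes nothing, by
        \<open>darboux_ground\<close>.\<close>
      also have "\<dots> = (\<Sum>w\<in>Z. fcoef f w * (\<rho> x * darboux (eigen w) x))"
        using Z(1) darboux_ground x by (intro sum.mono_neutral_left) (auto simp: ground_def)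
      also have "\<dots> = \<rho> x * darboux (partial f Z) x"
        unfolding partial_def by (simp add: darboux_sum darboux_cmult sum_distrib_left mult.left_commute)
      finally show ?thesis .
    qed
    have m: "g \<in> borel_measurable unit_measure"
      using g by (simp add: L2_space_def)
    have resid: "entire (f - partial f Z)" "eval_fps (f - partial f Z) 1 = 0"
      using f pf1 by auto
    have diff: "\<rho> x * darboux f x - \<rho> x * darboux (partial f Z) x = \<rho> x * darboux (f - partial f Z) x" for x
      by (simp add: darboux_diff f(1) right_diff_distrib)
    have "integrable unit_measure (\<lambda>x. (g x - \<rho> x * darboux f x)\<^sup>2)"
      "(\<integral>x. (g x - \<rho> x * darboux f x)\<^sup>2 \<partial>unit_measure) < \<epsilon>\<^sup>2 / 4"
      using q \<rho>f
        Bochner_Integration.integrable_cong[OF refl, of unit_measure "\<lambda>x. (g x - \<sigma> x * poly q (x\<^sup>2))\<^sup>2"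
          "\<lambda>x. (g x - \<rho> x * darboux f x)\<^sup>2"]
        Bochner_Integration.integral_cong[OF refl, of unit_measure "\<lambda>x. (g x - \<sigma> x * poly q (x\<^sup>2))\<^sup>2"
          "\<lambda>x. (g x - \<rho> x * darboux f x)\<^sup>2"] by simp_all
    from L2_close_trans(2)[OF m \<rho>_darboux(1)[OF f] \<rho>_darboux(1)[OF entire_partial pf1] this]
    have "(\<integral>x. (g x - \<rho> x * darboux (partial f Z) x)\<^sup>2 \<partial>unit_measure) < \<epsilon>\<^sup>2"
      unfolding diff using \<rho>_darboux(2,3)[OF resid] Z(3) by simp
    moreover have "(\<integral>x. (g x - h x)\<^sup>2 \<partial>unit_measure) = (\<integral>x. (g x - \<rho> x * darboux (partial f Z) x)\<^sup>2 \<partial>unit_measure)"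
      by (rule Bochner_Integration.integral_cong) (auto simp: h_eq)
    ultimately have "L2_norm unit_measure (\<lambda>x. g x - h x) < \<epsilon>"
      using \<open>\<epsilon> > 0\<close> real_sqrt_less_mono[of _ "\<epsilon>\<^sup>2"] by (auto simp: L2_norm_def)
    then show ?thesis
      using span by blast
  qed
  show ?thesis
    using mem dense by (auto simp: complete_in_L2_def)
qed

lemma measurable_powr_unit: "(\<lambda>x. x powr a) \<in> borel_measurable unit_measure"
  by (rule measurable_on_unit[OF continuous_on_powr_unit])

lemma complete_delta_op: "complete_in_L2 (mu_measure \<nu>) (\<lambda>n. delta_op \<nu> (phi \<nu> n)) {2..}"
  unfolding mu_measure_def
proof (rule complete_in_L2_density[OF complete_D_op measurable_powr_unit])
  show "x powr (2 * \<nu> + 1) = (x powr (\<nu> + 1 / 2))\<^sup>2" if "x \<in> space unit_measure" for x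
    using that by (simp add: powr_half_square)
qed (auto simp: D_op_psi)

text \<open>The change of weight is by x^(\<nu>+1/2) times the first eigenfunction, which is
  positive on (0,1).\<close>

lemma complete_d_op: "complete_in_L2 (eta_measure \<nu>) (\<lambda>n. d_op \<nu> (varphi \<nu> n)) {2..}"
  unfolding eta_measure_def
proof (rule complete_in_L2_density[OF complete_D_op])
  have "continuous_on {0<..<1} (\<lambda>x. x powr (\<nu> + 1 / 2) * (nrm 1 * eval_fps ground (x\<^sup>2)))"
    by (intro continuous_on_mult continuous_on_powr_unit entire_continuous_on_square continuous_on_const) simp
  then have "(\<lambda>x. x powr (\<nu> + 1 / 2) * (nrm 1 * eval_fps ground (x\<^sup>2))) \<in> borel_measurable unit_measure"
    by (rule measurable_on_unit)
  then show "(\<lambda>x. x powr (\<nu> + 1 / 2) * phi \<nu> 1 x) \<in> borel_measurable unit_measure"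
    by (subst measurable_cong[of _ _ "\<lambda>x. x powr (\<nu> + 1 / 2) * (nrm 1 * eval_fps ground (x\<^sup>2))"])
      (auto simp: phi_1_eq[simplified])
  fix x assume "x \<in> space unit_measure"
  then have x: "0 < x" "x < 1"
    by auto
  show "0 < x powr (\<nu> + 1 / 2) * phi \<nu> 1 x"
    using x phi_1_pos[OF x] by simp
  show "x powr (2 * \<nu> + 1) * (phi \<nu> 1 x)\<^sup>2 = (x powr (\<nu> + 1 / 2) * phi \<nu> 1 x)\<^sup>2"
    using x by (simp add: powr_half_square power_mult_distrib)
  fix n :: nat assume "n \<in> {2..}"
  then have "n \<ge> 1"
    by simp
  then show "D_op \<nu> (psi \<nu> n) x = x powr (\<nu> + 1 / 2) * phi \<nu> 1 x * d_op \<nu> (varphi \<nu> n) x"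
    using x d_op_varphi[of n x] by (simp add: D_op_psi mult.assoc)
qed

end

theorem theorem5p5:
  fixes \<nu> :: real
  assumes "\<nu> > -1"
  shows "complete_in_L2 (eta_measure \<nu>) (\<lambda>n. d_op \<nu> (varphi \<nu> n)) {2..}
       \<and> complete_in_L2 (mu_measure \<nu>) (\<lambda>n. delta_op \<nu> (phi \<nu> n)) {2..}
       \<and> complete_in_L2 unit_measure (\<lambda>n. D_op \<nu> (psi \<nu> n)) {2..}"
proof -
  interpret bessel_index \<nu>
    by unfold_locales (rule assms)
  show ?thesis
    using complete_d_op complete_delta_op complete_D_op by blast
qed

end
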